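(* Let $q\in[1,\infty]$ and $\boldsymbol p=(p_1,\dots,p_{2d})\in[1,\infty]^{2d}$ satisfy $$\kappa:=2-\Big(\tfrac1{p_1}+\cdots+\tfrac1{p_d}+\tfrac3{p_{d+1}}+\cdots+\tfrac3{p_{2d}}+\tfrac2q\Big)>0.$$ For any $\beta\in[0,\kappa)$ and $\lambda>0$ there is a constant $C=C(d,\boldsymbol p,q,\beta,\lambda)>0$ such that for all $T\in[0,1]$ and all measurable $f:\mathbb R^{1+2d}\to\mathbb R$, $$K^{(\beta)}_\lambda(f;T)\le C\,T^{(\kappa-\beta)/2}\,\|f\|_{\mathbb L^q(\mathbb L^{\boldsymbol p})}.$$ In particular, for any $\beta\in[0,\kappa)$, $\mathbb L^q(\mathbb L^{\boldsymbol p})\subset\mathbb K^{\rm p}_\beta$.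
   Context: Write $\boldsymbol x=(x_1,x_2)\in\mathbb R^d\times\mathbb R^d=\mathbb R^{2d}$ with scalar coordinates $x^{(1)},\dots,x^{(2d)}$; $\mathbb T_t\boldsymbol x:=(t^{-1/2}x_1,t^{-3/2}x_2)$. The mixed norm is $$\|f\|_{\mathbb L^q(\mathbb L^{\boldsymbol p})}=\Big(\int_{\mathbb R}\Big(\int_{\mathbb R}\cdots\Big(\int_{\mathbb R}|f(s,x^{(1)},\dots,x^{(2d)})|^{p_1}\mathrm dx^{(1)}\Big)^{\frac{p_2}{p_1}}\cdots\mathrm dx^{(2d)}\Big)^{\frac q{p_{2d}}}\mathrm ds\Big)^{\frac1q},$$ with the usual essential-supremum modification for infinite exponents, and $\mathbb L^q(\mathbb L^{\boldsymbol p})$ is the space of $f$ with finite norm. For $\beta\ge0,\lambda>0$ let $\eta^{(\beta)}_\lambda(t,\boldsymbol x):=t^{-\frac\beta2-2d}\mathrm e^{-\lambda|\mathbb T_t\boldsymbol x|^2}$, and for $\delta>0$, $$K^{(\beta)}_\lambda(f;\delta):=\sup_{t\ge0}\sup_{\boldsymbol x}\int_0^\delta\!\!\int_{\mathbb R^{2d}}\eta^{(\beta)}_\lambda(r,\boldsymbol y)\sum_{i,j\in\{0,1\}}|f(t+(-1)^ir,\boldsymbol x+(-1)^j\boldsymbol y)|\,\mathrm d\boldsymbol y\,\mathrm dr .$$ $\mathbb K_\beta:=\{f\in L^1_{loc}(\mathbb R^{1+2d}):K^{(\beta)}_\lambda(f;1)<\infty\ \forall\lambda>0\}$, $\mathbb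 K^{\rm o}_\beta:=\{f\in\mathbb K_\beta:\lim_{\delta\downarrow0}K^{(\beta)}_\lambda(f;\delta)=0\ \forall\lambda>0\}$, and $\mathbb K^{\rm p}_\beta$ is the set of $f\in\mathbb K^{\rm o}_\beta$ such that for all $p,\lambda>0$ there is $N\in\mathbb N$ with $\int_0^1 r^{-p}\,(K^{(\beta)}_\lambda(f;r))^N\,\mathrm dr<\infty$. *)

theory Defs
  imports "HOL-Analysis.Analysis" "HOL-Probability.Essential_Supremum"
begin

text \<open>
  A point of \<open>R^n\<close> is an element of \<open>real_pow n\<close>, i.e. a function on \<open>nat\<close> carrying the coordinates
  at the indices \<open>1, ..., n\<close> and equal to \<open>undefined\<close> elsewhere; this is the carrier of the product
  measure on \<open>{1..n}\<close>. For \<open>x = (x1, x2)\<close> in \<open>R^d \<times> R^d\<close>, the block \<open>x1\<close> consists of the coordinates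
  \<open>1, ..., d\<close> and \<open>x2\<close> of the coordinates \<open>d + 1, ..., 2d\<close>. The topology on \<open>nat \<Rightarrow> real\<close> (product
  topology) restricts to the Euclidean one on \<open>real_pow n\<close>.
\<close>

abbreviation real_pow :: "nat \<Rightarrow> (nat \<Rightarrow> real) set" where
  "real_pow n \<equiv> PiE {1..n} (\<lambda>_. UNIV)"

definition lebesgue_pow :: "nat \<Rightarrow> (nat \<Rightarrow> real) measure" where
  "lebesgue_pow n = completion (\<Pi>\<^sub>M i\<in>{1..n}. lborel)"

definition lebesgue_tx :: "nat \<Rightarrow> (real \<times> (nat \<Rightarrow> real)) measure" where
  "lebesgue_tx d = completion (lborel \<Otimes>\<^sub>M (\<Pi>\<^sub>M i\<in>{1..2*d}. lborel))"

text \<open>Powers of extended nonnegative numbers; only used with \<open>r > 0\<close>.\<close>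

definition enn_powr :: "ennreal \<Rightarrow> real \<Rightarrow> ennreal" where
  "enn_powr a r = (if a = top then top else ennreal (enn2real a powr r))"

definition Lp_norm :: "ennreal \<Rightarrow> (real \<Rightarrow> ennreal) \<Rightarrow> ennreal" where
  "Lp_norm p g =
     (if p = top then esssup lebesgue g
      else enn_powr (\<integral>\<^sup>+ y. enn_powr (g y) (enn2real p) \<partial>lebesgue) (1 / enn2real p))"

text \<open>
  \<open>coord_norm p k g x\<close> takes the \<open>L\<close>-norms of \<open>g\<close> in the coordinates \<open>1, ..., k\<close> successively, with
  exponents \<open>p 1, ..., p k\<close> (coordinate 1 innermost), the other coordinates being those of \<open>x\<close>.
\<close>

primrec coord_norm ::
  "(nat \<Rightarrow> ennreal) \<Rightarrow> nat \<Rightarrow> ((nat \<Rightarrow> real) \<Rightarrow> ennreal) \<Rightarrow> (nat \<Rightarrow> real) \<Rightarrow> ennreal" where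
  "coord_norm p 0 g x = g x"
| "coord_norm p (Suc k) g x = Lp_norm (p (Suc k)) (\<lambda>y. coord_norm p k g (x(Suc k := y)))"

text \<open>All coordinates \<open>1, ..., 2d\<close> of the base point are overwritten; \<open>\<lambda>_. undefined\<close> makes the
  points at which \<open>f\<close> is evaluated elements of \<open>real_pow (2 * d)\<close>.\<close>

definition mixed_norm ::
  "nat \<Rightarrow> ennreal \<Rightarrow> (nat \<Rightarrow> ennreal) \<Rightarrow> (real \<times> (nat \<Rightarrow> real) \<Rightarrow> real) \<Rightarrow> ennreal" where
  "mixed_norm d q p f =
     Lp_norm q (\<lambda>s. coord_norm p (2 * d) (\<lambda>x. ennreal \<bar>f (s, x)\<bar>) (\<lambda>_. undefined))"

definition mixed_space ::
  "nat \<Rightarrow> ennreal \<Rightarrow> (nat \<Rightarrow> ennreal) \<Rightarrow> (real \<times> (nat \<Rightarrow> real) \<Rightarrow> real) set" where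
  "mixed_space d q p = {f \<in> borel_measurable (lebesgue_tx d). mixed_norm d q p f < top}"

text \<open>Here \<open>1 / \<infinity> = 0\<close>, as \<open>inverse top = (0 :: ennreal)\<close>.\<close>

definition kappa :: "nat \<Rightarrow> ennreal \<Rightarrow> (nat \<Rightarrow> ennreal) \<Rightarrow> real" where
  "kappa d q p =
     2 - ((\<Sum>i = 1..d. enn2real (inverse (p i)))
        + (\<Sum>i = d + 1..2 * d. 3 * enn2real (inverse (p i)))
        + 2 * enn2real (inverse q))"

definition kin_scale :: "nat \<Rightarrow> real \<Rightarrow> (nat \<Rightarrow> real) \<Rightarrow> (nat \<Rightarrow> real)" where
  "kin_scale d t x =
     (\<lambda>i\<in>{1..2*d}. if i \<le> d then t powr (- 1 / 2) * x i else t powr (- 3 / 2) * x i)"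

definition eta :: "nat \<Rightarrow> real \<Rightarrow> real \<Rightarrow> real \<Rightarrow> (nat \<Rightarrow> real) \<Rightarrow> real" where
  "eta d \<beta> lam t x =
     t powr (- \<beta> / 2 - 2 * real d) * exp (- lam * (L2_set (kin_scale d t x) {1..2*d})\<^sup>2)"

definition Kato ::
  "nat \<Rightarrow> real \<Rightarrow> real \<Rightarrow> (real \<times> (nat \<Rightarrow> real) \<Rightarrow> real) \<Rightarrow> real \<Rightarrow> ennreal" where
  "Kato d \<beta> lam f \<delta> =
     (SUP t\<in>{0..}. SUP x\<in>real_pow (2 * d).
        \<integral>\<^sup>+ r\<in>{0..\<delta>}.
          (\<integral>\<^sup>+ y. ennreal (eta d \<beta> lam r y) *
             (\<Sum>i\<in>{0, 1::nat}. \<Sum>j\<in>{0, 1::nat}.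
                ennreal \<bar>f (t + (- 1) ^ i * r, \<lambda>k\<in>{1..2*d}. x k + (- 1) ^ j * y k)\<bar>)
           \<partial>lebesgue_pow (2 * d)) \<partial>lebesgue)"

definition L1_loc :: "nat \<Rightarrow> (real \<times> (nat \<Rightarrow> real) \<Rightarrow> real) set" where
  "L1_loc d = {f \<in> borel_measurable (lebesgue_tx d).
     \<forall>A. compact A \<and> A \<subseteq> UNIV \<times> real_pow (2 * d) \<longrightarrow> set_integrable (lebesgue_tx d) A f}"

definition Kato_class :: "nat \<Rightarrow> real \<Rightarrow> (real \<times> (nat \<Rightarrow> real) \<Rightarrow> real) set" where
  "Kato_class d \<beta> = {f \<in> L1_loc d. \<forall>lam>0. Kato d \<beta> lam f 1 < top}"

definition Kato_class_o :: "nat \<Rightarrow> real \<Rightarrow> (real \<times> (nat \<Rightarrow> real) \<Rightarrow> real) set" where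
  "Kato_class_o d \<beta> =
     {f \<in> Kato_class d \<beta>. \<forall>lam>0. ((\<lambda>\<delta>. Kato d \<beta> lam f \<delta>) \<longlongrightarrow> 0) (at_right 0)}"

definition Kato_class_p :: "nat \<Rightarrow> real \<Rightarrow> (real \<times> (nat \<Rightarrow> real) \<Rightarrow> real) set" where
  "Kato_class_p d \<beta> =
     {f \<in> Kato_class_o d \<beta>. \<forall>a>0. \<forall>lam>0. \<exists>N::nat.
        (\<integral>\<^sup>+ r\<in>{0..1}. (ennreal (r powr (- a)) * (Kato d \<beta> lam f r) ^ N) \<partial>lebesgue) < top}"

end

theory Submission
  imports Defs "HOL-Probability.Distributions"
begin

text \<open>
  For fixed \<open>r\<close> the kernel \<open>\<eta>(r, \<cdot>)\<close> is a product of one-dimensional Gaussians, so the one-dimensional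
  Hoelder inequality, applied coordinate by coordinate, bounds the inner integral by
  \<open>K r powr (a - 1/q')\<close> times the mixed norm of the time slice, where \<open>a = (\<kappa> - \<beta>) / 2\<close>, \<open>q'\<close> is
  conjugate to \<open>q\<close>, and the power of \<open>r\<close> comes from rescaling the Gaussians. Hoelder in time on \<open>[0, T]\<close>
  then produces \<open>T powr a\<close>, because \<open>r powr (a - 1/q')\<close> has a finite \<open>L\<close>-norm of exponent \<open>q'\<close> on
  \<open>[0, 1]\<close>. Local integrability follows in the same way with indicators of intervals in place of the
  Gaussians. Since \<open>f\<close> is only Lebesgue measurable, its slices may fail to be measurable; it is therefore
  dominated by a Borel function that equals \<open>\<bar>f\<bar>\<close> almost everywhere and \<open>\<infinity>\<close> on an exceptional null set,
  which does not change the mixed norm.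
\<close>

section \<open>One-dimensional norms\<close>

lemma enn_powr_ennreal: "0 \<le> x \<Longrightarrow> enn_powr (ennreal x) r = ennreal (x powr r)"
  by (simp add: enn_powr_def)

lemma enn_powr_top [simp]: "enn_powr top r = top"
  by (simp add: enn_powr_def)

lemma enn_powr_0 [simp]: "enn_powr 0 r = 0"
  by (simp add: enn_powr_def)

lemma enn_powr_1 [simp]: "enn_powr a 1 = a"
  by (cases a) (auto simp: enn_powr_def)

lemma enn_powr_eq_0_iff [simp]: "enn_powr a r = 0 \<longleftrightarrow> a = 0"
  by (cases a) (auto simp: enn_powr_def)

lemma enn_powr_eq_top_iff [simp]: "enn_powr a r = top \<longleftrightarrow> a = top"
  by (simp add: enn_powr_def)

lemma enn_powr_less_top_iff [simp]: "enn_powr a r < top \<longleftrightarrow> a < top"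
  by (simp flip: less_top)

text \<open>The power fixes both 0 and \<open>top\<close>, so the convention 0 * \<open>top\<close>
  = 0 survives on both sides.\<close>

lemma enn_powr_mult: "enn_powr (a * b) r = enn_powr a r * enn_powr b r"
proof (cases a; cases b)
  fix x y :: real assume "0 \<le> x" "a = ennreal x" "0 \<le> y" "b = ennreal y"
  then show ?thesis
    by (simp add: enn_powr_ennreal powr_mult flip: ennreal_mult)
next
  fix x :: real assume "0 \<le> x" "a = ennreal x" "b = top"
  then show ?thesis
    by (cases "x = 0") (auto simp: ennreal_mult_top enn_powr_ennreal ennreal_eq_0_iff)
next
  fix y :: real assume "a = top" "0 \<le> y" "b = ennreal y"
  then show ?thesis
    by (cases "y = 0") (auto simp: ennreal_top_mult enn_powr_ennreal ennreal_eq_0_iff)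
next
  assume "a = top" "b = top"
  then show ?thesis by simp
qed

lemma enn_powr_powr: "enn_powr (enn_powr a r) s = enn_powr a (r * s)"
  by (cases a) (auto simp: enn_powr_ennreal powr_powr)

lemma measurable_enn_powr [measurable (raw)]:
  assumes [measurable]: "f \<in> borel_measurable M"
  shows "(\<lambda>x. enn_powr (f x) r) \<in> borel_measurable M"
  unfolding enn_powr_def by measurable

section \<open>Young and Hoelder inequalities for nonnegative integrals\<close>

lemma ennreal_Young:
  fixes P Q :: real
  assumes PQ: "P > 1" "Q > 1" "1 / P + 1 / Q = 1"
  shows "a * b \<le> ennreal (1 / P) * enn_powr a P + ennreal (1 / Q) * enn_powr b Q"
proof (cases "a = top \<or> b = top")
  case True
  then show ?thesis using PQ by (auto simp: ennreal_mult_top)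
next
  case False
  then obtain x y where "a = ennreal x" "b = ennreal y" "x \<ge> 0" "y \<ge> 0"
    by (cases a; cases b) auto
  then show ?thesis
    using Youngs_inequality[OF PQ, of x y] PQ
    by (simp add: enn_powr_ennreal flip: ennreal_mult ennreal_plus)
qed

text \<open>Normalise both factors to norm 1 and integrate Young's inequality. This needs both norms
  positive and finite: if one is 0, that factor and hence the product vanish almost everywhere; if
  neither is 0 and one is \<open>top\<close>, the right side is \<open>top\<close>.\<close>

lemma nn_integral_Holder:
  fixes P Q :: real
  assumes PQ: "P > 1" "Q > 1" "1 / P + 1 / Q = 1"
  assumes [measurable]: "u \<in> borel_measurable M" "v \<in> borel_measurable M"
  shows "(\<integral>\<^sup>+x. u x * v x \<partial>M) \<le>
    enn_powr (\<integral>\<^sup>+x. enn_powr (u x) P \<partial>M) (1 / P) * enn_powr (\<integral>\<^sup>+x. enn_powr (v x) Q \<partial>M) (1 / Q)"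
    (is "_ \<le> ?A * ?B")
proof -
  consider "?A = 0" | "?B = 0" | "?A \<noteq> 0" "?B \<noteq> 0" "?A = top \<or> ?B = top"
    | "?A \<noteq> 0" "?B \<noteq> 0" "?A \<noteq> top" "?B \<noteq> top" by blast
  then show ?thesis
  proof cases
    case 1
    then have "AE x in M. u x = 0" by (simp add: nn_integral_0_iff_AE)
    then have "(\<integral>\<^sup>+x. u x * v x \<partial>M) = 0"
      by (subst nn_integral_0_iff_AE) auto
    then show ?thesis by simp
  next
    case 2
    then have "AE x in M. v x = 0" by (simp add: nn_integral_0_iff_AE)
    then have "(\<integral>\<^sup>+x. u x * v x \<partial>M) = 0"
      by (subst nn_integral_0_iff_AE) auto
    then show ?thesis by simp
  next
    case 3
    then have "?A * ?B = top"
      using ennreal_mult_eq_top_iff by blast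
    then show ?thesis by (metis top_greatest)
  next
    case 4
    then obtain a b where ab: "?A = ennreal a" "?B = ennreal b" "a > 0" "b > 0"
      by (cases ?A; cases ?B) (auto simp: ennreal_eq_0_iff less_le)
    \<comment> \<open>\<open>c\<close> and \<open>e\<close> are the normalising factors:
      \<open>c * u\<close> and \<open>e * v\<close> have norm 1.\<close>
    define c where "c = 1 / a"
    define e where "e = 1 / b"
    have ce: "c > 0" "e > 0" using ab by (auto simp: c_def e_def)
    have IA: "(\<integral>\<^sup>+x. enn_powr (u x) P \<partial>M) = ennreal (a powr P)"
    proof -
      have "1 / P * P = 1" using PQ by simp
      then show ?thesis
        using arg_cong[OF ab(1), of "\<lambda>z. enn_powr z P"] ab(3)
        by (simp only: enn_powr_powr enn_powr_1 enn_powr_ennreal less_imp_le)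
    qed
    have IB: "(\<integral>\<^sup>+x. enn_powr (v x) Q \<partial>M) = ennreal (b powr Q)"
    proof -
      have "1 / Q * Q = 1" using PQ by simp
      then show ?thesis
        using arg_cong[OF ab(2), of "\<lambda>z. enn_powr z Q"] ab(4)
        by (simp only: enn_powr_powr enn_powr_1 enn_powr_ennreal less_imp_le)
    qed
    have "ennreal (c * e) * (\<integral>\<^sup>+x. u x * v x \<partial>M) = (\<integral>\<^sup>+x. (ennreal c * u x) * (ennreal e * v x) \<partial>M)"
      using ce by (subst nn_integral_cmult[symmetric]) (auto simp: ennreal_mult ac_simps)
    also have "\<dots> \<le> (\<integral>\<^sup>+x. ennreal (1 / P) * enn_powr (ennreal c * u x) P
        + ennreal (1 / Q) * enn_powr (ennreal e * v x) Q \<partial>M)"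
      by (intro nn_integral_mono ennreal_Young PQ)
    also have "\<dots> = ennreal (1 / P) * (ennreal (c powr P) * ennreal (a powr P))
        + ennreal (1 / Q) * (ennreal (e powr Q) * ennreal (b powr Q))"
      using ce by (simp add: nn_integral_add nn_integral_cmult enn_powr_mult enn_powr_ennreal IA IB)
    also have "\<dots> = 1"
      using ab ce PQ by (simp add: c_def e_def powr_divide flip: ennreal_mult ennreal_plus)
    \<comment> \<open>Multiplying by \<open>a * b\<close>, the inverse of \<open>c * e\<close>,
      undoes the normalisation without dividing in \<open>ennreal\<close>.\<close>
    finally have "ennreal (a * b) * (ennreal (c * e) * (\<integral>\<^sup>+x. u x * v x \<partial>M)) \<le> ennreal (a * b) * 1"
      by (rule mult_left_mono) simp
    moreover have "ennreal (a * b) * (ennreal (c * e) * (\<integral>\<^sup>+x. u x * v x \<partial>M)) = (\<integral>\<^sup>+x. u x * v x \<partial>M)"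
      using ab ce by (simp add: c_def e_def flip: mult.assoc ennreal_mult)
    ultimately show ?thesis
      using ab by (simp add: ennreal_mult)
  qed
qed

section \<open>Norms under null sets, parameters and substitutions\<close>

lemma esssup_completion:
  assumes "g \<in> borel_measurable M"
  shows "esssup (completion M) g = esssup M g"
  using assms by (simp add: esssup_eq_AE measurable_completion AE_completion_iff)

text \<open>Passes to Lebesgue measure on the Borel sets, where Tonelli and affine substitution are
  applied. Borel measurability matters for the essential supremum, which is infinite on functions
  not measurable for the measure at hand.\<close>

lemma Lp_norm_lborel:
  assumes "g \<in> borel_measurable borel"
  shows "Lp_norm p g = (if p = top then esssup lborel g
    else enn_powr (\<integral>\<^sup>+ y. enn_powr (g y) (enn2real p) \<partial>lborel) (1 / enn2real p))"
  using assms by (simp add: Lp_norm_def nn_integral_completion esssup_completion)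

lemma Lp_norm_1 [simp]: "Lp_norm 1 g = (\<integral>\<^sup>+ y. g y \<partial>lborel)"
  by (simp add: Lp_norm_def nn_integral_completion)

lemma Lp_norm_top: "g \<in> borel_measurable borel \<Longrightarrow> Lp_norm top g = esssup lborel g"
  by (simp add: Lp_norm_lborel)

lemma borel_measurable_completion_cong_AE:
  assumes "f \<in> borel_measurable (completion M)" "AE x in M. f x = g x"
  shows "g \<in> borel_measurable (completion M)"
proof (rule measurableI)
  fix A :: "'b set" assume A: "A \<in> sets borel"
  show "g -` A \<inter> space (completion M) \<in> sets (completion M)"
  proof (rule completion.in_sets_AE)
    show "f -` A \<inter> space (completion M) \<in> sets (completion M)"
      using assms(1) A by (rule measurable_sets)
    show "AE x in completion M. (x \<in> f -` A \<inter> space (completion M)) = (x \<in> g -` A \<inter> space (completion M))"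
      using assms(2) by (auto simp: AE_completion_iff elim: eventually_mono)
  qed simp
qed simp

text \<open>No measurability is needed: \<open>esssup\<close> is \<open>\<infinity>\<close> on nonmeasurable functions, and Lebesgue
  measurability is invariant under changes on null sets.\<close>

lemma Lp_norm_cong_AE:
  assumes "AE x in lborel. f x = g x"
  shows "Lp_norm p f = Lp_norm p g"
proof (cases "p = top")
  case True
  have ae: "AE x in lebesgue. f x = g x" "AE x in lborel. g x = f x"
    using assms by (auto simp: AE_completion_iff elim: eventually_mono)
  show ?thesis
  proof (cases "f \<in> borel_measurable lebesgue")
    case f: True
    then have g: "g \<in> borel_measurable lebesgue"
      using assms by (rule borel_measurable_completion_cong_AE)
    show ?thesis
      using True esssup_AE_cong[OF f g ae(1)] by (simp add: Lp_norm_def)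
  next
    case False
    then have "g \<notin> borel_measurable lebesgue"
      using borel_measurable_completion_cong_AE[OF _ ae(2)] by blast
    with False True show ?thesis by (simp add: Lp_norm_def esssup_non_measurable)
  qed
next
  case False
  have "(\<integral>\<^sup>+ y. enn_powr (f y) (enn2real p) \<partial>lebesgue) = (\<integral>\<^sup>+ y. enn_powr (g y) (enn2real p) \<partial>lebesgue)"
    using assms by (intro nn_integral_cong_AE) (auto simp: AE_completion_iff elim: eventually_mono)
  with False show ?thesis by (simp add: Lp_norm_def)
qed

text \<open>For finite exponents this is Tonelli. The essential supremum exceeds \<open>c\<close>
  exactly when the superlevel set at \<open>c\<close> has positive measure, and that measure depends
  measurably on the parameter.\<close>

lemma measurable_Lp_norm:
  assumes [measurable]: "case_prod G \<in> borel_measurable (M \<Otimes>\<^sub>M borel)"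
  shows "(\<lambda>x. Lp_norm p (G x)) \<in> borel_measurable M"
proof (cases "p = top")
  case False
  have G [measurable]: "case_prod G \<in> borel_measurable (M \<Otimes>\<^sub>M lborel)"
    using assms by (simp cong: measurable_cong_sets)
  have "G x \<in> borel_measurable borel" if "x \<in> space M" for x
    using measurable_Pair2[OF assms that] by simp
  then have "(\<lambda>x. Lp_norm p (G x)) \<in> borel_measurable M \<longleftrightarrow>
    (\<lambda>x. enn_powr (\<integral>\<^sup>+ y. enn_powr (G x y) (enn2real p) \<partial>lborel) (1 / enn2real p)) \<in> borel_measurable M"
    using False by (intro measurable_cong) (simp add: Lp_norm_lborel)
  also have \<dots>
    by measurable
  finally show ?thesis .
next
  case True
  have G [measurable]: "case_prod G \<in> borel_measurable (M \<Otimes>\<^sub>M lborel)"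
    using assms by (simp cong: measurable_cong_sets)
  have Gx: "G x \<in> borel_measurable lborel" if "x \<in> space M" for x
    using measurable_Pair2[OF assms that] by simp
  show ?thesis
  proof (rule borel_measurableI_greater)
    fix c :: ennreal
    have *: "c < esssup lborel (G x) \<longleftrightarrow> emeasure lborel {y \<in> space lborel. c < G x y} \<noteq> 0" if "x \<in> space M" for x
    proof
      assume "c < esssup lborel (G x)"
      from esssup_pos_measure[OF Gx[OF that] this]
      show "emeasure lborel {y \<in> space lborel. c < G x y} \<noteq> 0" by auto
    next
      assume pos: "emeasure lborel {y \<in> space lborel. c < G x y} \<noteq> 0"
      show "c < esssup lborel (G x)"
      proof (rule ccontr)
        assume "\<not> c < esssup lborel (G x)"
        then have "AE y in lborel. G x y \<le> c"
          using esssup_AE[of "G x" lborel] by (auto elim!: eventually_mono)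
        then have "emeasure lborel {y \<in> space lborel. \<not> G x y \<le> c} = 0"
          using Gx[OF that] by (subst (asm) AE_iff_measurable[OF _ refl]) (auto simp: not_le)
        with pos show False by (simp add: not_le)
      qed
    qed
    \<comment> \<open>The measure of the superlevel set is written as a parameter integral of an
      indicator, so that its measurability in \<open>x\<close> is immediate.\<close>
    have "{x \<in> space M. c < Lp_norm p (G x)} =
      {x \<in> space M. (\<integral>\<^sup>+ y. indicator {z. c < z} (G x y) \<partial>lborel) \<noteq> 0}"
    proof (intro Collect_cong conj_cong refl)
      fix x assume x: "x \<in> space M"
      have "(\<integral>\<^sup>+ y. indicator {z. c < z} (G x y) \<partial>lborel) = (\<integral>\<^sup>+ y. indicator {y \<in> space lborel. c < G x y} y \<partial>lborel)"
        by (intro nn_integral_cong) (auto simp: indicator_def)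
      also have "\<dots> = emeasure lborel {y \<in> space lborel. c < G x y}"
        using Gx[OF x] by (intro nn_integral_indicator) (simp add: pred_def)
      finally show "(c < Lp_norm p (G x)) = ((\<integral>\<^sup>+ y. indicator {z. c < z} (G x y) \<partial>lborel) \<noteq> 0)"
        using *[OF x] True Gx[OF x] by (simp add: Lp_norm_top)
    qed
    also have "\<dots> \<in> sets M" by measurable
    finally show "{x \<in> space M. c < Lp_norm p (G x)} \<in> sets M" .
  qed
qed

text \<open>The Jacobian contributes the power -1/p of the scale factor. For \<open>p = top\<close>
  this power is 0: affine bijections preserve null sets, hence the essential supremum.\<close>

lemma Lp_norm_affine:
  assumes [measurable]: "g \<in> borel_measurable borel" and p: "p \<ge> 1" and s: "s \<noteq> 0"
  shows "Lp_norm p (\<lambda>y. g (c + s * y)) = ennreal (\<bar>s\<bar> powr (- enn2real (inverse p))) * Lp_norm p g"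
proof (cases "p = top")
  case True
  have "(AE y in lborel. g (c + s * y) \<le> z) \<longleftrightarrow> (AE y in lborel. g y \<le> z)" for z
  proof
    assume "AE y in lborel. g (c + s * y) \<le> z"
    then have "AE y in lborel. g (c + s * (- c / s + (1 / s) * y)) \<le> z"
      using s by (intro AE_borel_affine[where P = "\<lambda>y. g (c + s * y) \<le> z"]) auto
    then show "AE y in lborel. g y \<le> z"
      using s by (simp add: field_simps)
  next
    assume "AE y in lborel. g y \<le> z"
    then show "AE y in lborel. g (c + s * y) \<le> z"
      using s by (intro AE_borel_affine[where P = "\<lambda>y. g y \<le> z"]) auto
  qed
  then show ?thesis
    using s True by (simp add: Lp_norm_lborel esssup_eq_AE)
next
  case False
  with p obtain P where P: "p = ennreal P" "P \<ge> 1"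
    by (cases p) auto
  let ?I = "\<integral>\<^sup>+ y. enn_powr (g (c + s * y)) P \<partial>lborel"
  have inv: "enn2real (inverse p) = 1 / P"
    using P by (simp add: inverse_ennreal divide_inverse)
  have "Lp_norm p g = enn_powr (ennreal \<bar>s\<bar> * ?I) (1 / P)"
    using P s nn_integral_real_affine[where c = s and t = c and f = "\<lambda>y. enn_powr (g y) P"]
    by (simp add: Lp_norm_lborel)
  also have "\<dots> = ennreal (\<bar>s\<bar> powr (1 / P)) * Lp_norm p (\<lambda>y. g (c + s * y))"
    using P by (simp add: Lp_norm_lborel enn_powr_mult enn_powr_ennreal)
  finally have "ennreal (\<bar>s\<bar> powr (- 1 / P)) * Lp_norm p g =
      (ennreal (\<bar>s\<bar> powr (- 1 / P)) * ennreal (\<bar>s\<bar> powr (1 / P))) * Lp_norm p (\<lambda>y. g (c + s * y))"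
    by (simp add: mult.assoc)
  also have "ennreal (\<bar>s\<bar> powr (- 1 / P)) * ennreal (\<bar>s\<bar> powr (1 / P)) = 1"
    using s by (simp flip: ennreal_mult powr_add)
  finally show ?thesis by (simp add: inv)
qed

section \<open>Conjugate exponents and Hoelder's inequality with endpoints\<close>

definition conj_exp :: "ennreal \<Rightarrow> ennreal" where
  "conj_exp p = (if p = 1 then top else if p = top then 1 else ennreal (enn2real p / (enn2real p - 1)))"

lemma conj_exp_cases [consumes 1, case_names one top real]:
  assumes "p \<ge> 1"
  obtains "p = 1" "conj_exp p = top" | "p = top" "conj_exp p = 1"
  | P Q where "p = ennreal P" "conj_exp p = ennreal Q" "P > 1" "Q > 1" "1 / P + 1 / Q = 1"
proof (cases p)
  case top
  then show ?thesis using that(2) by (simp add: conj_exp_def)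
next
  case (real P)
  show ?thesis
  proof (cases "P = 1")
    case True
    with real show ?thesis using that(1) by (simp add: conj_exp_def)
  next
    case False
    then have P: "P > 1" using real assms by auto
    then have "p \<noteq> 1" using real by auto
    with P show ?thesis
      by (intro that(3)[of P "P / (P - 1)"]) (auto simp: real conj_exp_def field_simps)
  qed
qed

lemma conj_exp_ge_1: "p \<ge> 1 \<Longrightarrow> conj_exp p \<ge> 1"
  by (cases p rule: conj_exp_cases) auto

text \<open>Conjugacy as an identity of reals, valid at both endpoints since the inverse of
  \<open>top\<close> is 0. The exponent computations use this form.\<close>

lemma inverse_conj_exp: "p \<ge> 1 \<Longrightarrow> enn2real (inverse (conj_exp p)) = 1 - enn2real (inverse p)"
  by (cases p rule: conj_exp_cases) (auto simp: inverse_ennreal field_simps)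

text \<open>At an endpoint, one factor is bounded almost everywhere by its essential supremum, which
  is then pulled out of the integral.\<close>

lemma Lp_norm_Holder:
  assumes [measurable]: "u \<in> borel_measurable borel" "v \<in> borel_measurable borel" and p: "p \<ge> 1"
  shows "(\<integral>\<^sup>+x. u x * v x \<partial>lborel) \<le> Lp_norm (conj_exp p) u * Lp_norm p v"
  using p
proof (cases p rule: conj_exp_cases)
  case one
  have "(\<integral>\<^sup>+x. u x * v x \<partial>lborel) \<le> (\<integral>\<^sup>+x. esssup lborel u * v x \<partial>lborel)"
    using esssup_AE[of u lborel] by (intro nn_integral_mono_AE) (auto elim!: eventually_mono intro!: mult_right_mono)
  then show ?thesis using one by (simp add: Lp_norm_top nn_integral_cmult)
next
  case top
  have "(\<integral>\<^sup>+x. u x * v x \<partial>lborel) \<le> (\<integral>\<^sup>+x. u x * esssup lborel v \<partial>lborel)"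
    using esssup_AE[of v lborel] by (intro nn_integral_mono_AE) (auto elim!: eventually_mono intro!: mult_left_mono)
  then show ?thesis using top by (simp add: Lp_norm_top nn_integral_multc)
next
  case (real P Q)
  then show ?thesis
    using nn_integral_Holder[of Q P u lborel v] by (simp add: Lp_norm_lborel add.commute)
qed

text \<open>Translations and reflections preserve the norm. Hence the bound is uniform in the base
  point \<open>c\<close> and covers both signs occurring in the Kato functional.\<close>

lemma Lp_norm_Holder_affine:
  assumes [measurable]: "u \<in> borel_measurable borel" "v \<in> borel_measurable borel"
    and p: "p \<ge> 1" and s: "\<bar>s\<bar> = 1"
  shows "(\<integral>\<^sup>+x. u x * v (c + s * x) \<partial>lborel) \<le> Lp_norm (conj_exp p) u * Lp_norm p v"
proof -
  have "Lp_norm p (\<lambda>y. v (c + s * y)) = Lp_norm p v"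
    using s by (subst Lp_norm_affine) (auto simp: p)
  with Lp_norm_Holder[of u "\<lambda>y. v (c + s * y)" p] p show ?thesis by simp
qed

section \<open>Iterated norms\<close>

text \<open>The coordinates 1, ..., k of the base point are overwritten before \<open>g\<close> is
  evaluated.\<close>

lemma coord_norm_cong_base:
  "(\<And>i. i \<notin> {1..k} \<Longrightarrow> x i = x' i) \<Longrightarrow> coord_norm p k g x = coord_norm p k g x'"
proof (induction k arbitrary: x x')
  case 0
  then have "x = x'" by auto
  then show ?case by simp
next
  case (Suc k)
  have "coord_norm p k g (x(Suc k := y)) = coord_norm p k g (x'(Suc k := y))" for y
    using Suc.prems by (intro Suc.IH) (auto simp: le_Suc_eq)
  then show ?case by simp
qed

text \<open>Freezing a coordinate beyond the first \<open>k\<close> commutes with the norms in those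
  \<open>k\<close> coordinates. Inductions on the dimension use this to pass to slices in the
  outermost coordinate.\<close>

lemma coord_norm_fun_upd:
  "k < m \<Longrightarrow> coord_norm p k (\<lambda>w. g (w(m := z))) x = coord_norm p k g (x(m := z))"
  by (induction k arbitrary: x) (simp_all add: fun_upd_twist)

text \<open>Each further norm is a parameter norm composed with a measurable coordinate update. The
  extra parameter \<open>s\<close> will be the time variable, or a frozen coordinate in an
  induction.\<close>

lemma measurable_coord_norm:
  assumes G: "(\<lambda>(s, x). G s x) \<in> borel_measurable (M \<Otimes>\<^sub>M (\<Pi>\<^sub>M i\<in>{1..n}. lborel))" and "k \<le> n"
  shows "(\<lambda>(s, x). coord_norm p k (G s) x) \<in> borel_measurable (M \<Otimes>\<^sub>M (\<Pi>\<^sub>M i\<in>{1..n}. lborel))"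
  using \<open>k \<le> n\<close>
proof (induction k)
  case 0
  then show ?case using G by simp
next
  case (Suc k)
  let ?P = "\<Pi>\<^sub>M i\<in>{1..n}. lborel :: real measure"
  have IH [measurable]: "(\<lambda>(s, x). coord_norm p k (G s) x) \<in> borel_measurable (M \<Otimes>\<^sub>M ?P)"
    using Suc by simp
  have upd [measurable]: "(\<lambda>w. (snd (fst w))(Suc k := snd w)) \<in> (M \<Otimes>\<^sub>M ?P) \<Otimes>\<^sub>M borel \<rightarrow>\<^sub>M ?P"
    using Suc.prems by (intro measurable_fun_upd[where J = "{1..n}"]) auto
  have "(\<lambda>w. (fst (fst w), (snd (fst w))(Suc k := snd w))) \<in> (M \<Otimes>\<^sub>M ?P) \<Otimes>\<^sub>M borel \<rightarrow>\<^sub>M M \<Otimes>\<^sub>M ?P"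
    by measurable
  from measurable_compose[OF this IH]
  have "(\<lambda>((s, x), y). coord_norm p k (G s) (x(Suc k := y))) \<in> borel_measurable ((M \<Otimes>\<^sub>M ?P) \<Otimes>\<^sub>M borel)"
    by (simp add: case_prod_beta')
  then have "(\<lambda>w. Lp_norm (p (Suc k)) (\<lambda>y. coord_norm p k (G (fst w)) ((snd w)(Suc k := y))))
      \<in> borel_measurable (M \<Otimes>\<^sub>M ?P)"
    by (intro measurable_Lp_norm) (simp add: case_prod_beta')
  then show ?case by (simp add: case_prod_beta')
qed

lemma measurable_coord_norm_undefined:
  assumes G: "(\<lambda>(s, x). G s x) \<in> borel_measurable (M \<Otimes>\<^sub>M (\<Pi>\<^sub>M i\<in>{1..n}. lborel))"
  shows "(\<lambda>s. coord_norm p n (G s) (\<lambda>_. undefined)) \<in> borel_measurable M"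
proof -
  \<comment> \<open>Any point of the product space will do: its first \<open>n\<close> coordinates
    are overwritten, and elsewhere it is \<open>undefined\<close>.\<close>
  have "(\<lambda>i\<in>{1..n}. 0) \<in> space (\<Pi>\<^sub>M i\<in>{1..n}. lborel)"
    by (auto simp: space_PiM)
  from measurable_Pair1[OF measurable_coord_norm[OF G order_refl, of p] this]
  have "(\<lambda>s. coord_norm p n (G s) (\<lambda>i\<in>{1..n}. 0)) \<in> borel_measurable M" by simp
  also have "(\<lambda>s. coord_norm p n (G s) (\<lambda>i\<in>{1..n}. 0)) = (\<lambda>s. coord_norm p n (G s) (\<lambda>_. undefined))"
    by (intro ext coord_norm_cong_base) auto
  finally show ?thesis .
qed

text \<open>Carrying the affine substitution along in the induction avoids a change of variables in the
  product measure.\<close>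

lemma coord_norm_Holder:
  assumes "F \<in> borel_measurable (\<Pi>\<^sub>M i\<in>{1..n}. lborel)"
    and e: "\<And>i. i \<in> {1..n} \<Longrightarrow> e i \<in> borel_measurable borel"
    and p: "\<And>i. i \<in> {1..n} \<Longrightarrow> p i \<ge> 1"
    and s: "\<bar>s\<bar> = 1"
  shows "(\<integral>\<^sup>+ y. (\<Prod>i\<in>{1..n}. e i (y i)) * F (\<lambda>i\<in>{1..n}. x i + s * y i) \<partial>(\<Pi>\<^sub>M i\<in>{1..n}. lborel))
    \<le> (\<Prod>i\<in>{1..n}. Lp_norm (conj_exp (p i)) (e i)) * coord_norm p n F (\<lambda>_. undefined)"
  using assms(1-3)
proof (induction n arbitrary: F)
  case 0
  then show ?case by (simp add: PiM_empty restrict_def nn_integral_count_space_finite)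
next
  case (Suc n)
  interpret product_sigma_finite "\<lambda>_ :: nat. lborel :: real measure" ..
  let ?P = "\<lambda>n. \<Pi>\<^sub>M i\<in>{1..n}. lborel :: real measure"
  have ins: "{1..Suc n} = insert (Suc n) {1..n}" by auto
  have e [measurable]: "e (Suc n) \<in> borel_measurable borel" "\<And>i. i \<in> {1..n} \<Longrightarrow> e i \<in> borel_measurable borel"
    using Suc.prems(2) by auto
  have F [measurable]: "F \<in> borel_measurable (?P (Suc n))" by (rule Suc.prems)
  have upd: "(\<lambda>w. (snd w)(Suc n := fst w)) \<in> lborel \<Otimes>\<^sub>M ?P n \<rightarrow>\<^sub>M ?P (Suc n)"
    by (intro measurable_fun_upd[where J = "{1..n}"]) auto
  have G: "(\<lambda>(z, w). F (w(Suc n := z))) \<in> borel_measurable (lborel \<Otimes>\<^sub>M ?P n)"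
    using measurable_compose[OF upd F] by (simp add: case_prod_beta')
  have Gz: "(\<lambda>w. F (w(Suc n := z))) \<in> borel_measurable (?P n)" for z
    using measurable_Pair2[OF G, of z] by simp
  \<comment> \<open>\<open>?N z\<close> is the norm of the slice at last coordinate
    \<open>z\<close>; its own norm in \<open>z\<close> is, by definition, the full iterated
    norm.\<close>
  let ?N = "\<lambda>z. coord_norm p n F ((\<lambda>_. undefined)(Suc n := z))"
  have N: "?N \<in> borel_measurable borel"
    using measurable_coord_norm_undefined[OF G, of p] by (simp add: coord_norm_fun_upd)
  let ?C = "\<Prod>i\<in>{1..n}. Lp_norm (conj_exp (p i)) (e i)"
  have "(\<lambda>y. (\<Prod>i\<in>{1..Suc n}. e i (y i)) * F (\<lambda>i\<in>{1..Suc n}. x i + s * y i)) \<in> borel_measurable (?P (Suc n))"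
    using Suc.prems(2) by measurable
  then have "(\<integral>\<^sup>+ y. (\<Prod>i\<in>{1..Suc n}. e i (y i)) * F (\<lambda>i\<in>{1..Suc n}. x i + s * y i) \<partial>?P (Suc n))
    = (\<integral>\<^sup>+ z. \<integral>\<^sup>+ y. (\<Prod>i\<in>{1..Suc n}. e i ((y(Suc n := z)) i))
        * F (\<lambda>i\<in>{1..Suc n}. x i + s * (y(Suc n := z)) i) \<partial>?P n \<partial>lborel)"
    unfolding ins by (intro product_nn_integral_insert_rev) auto
  also have "\<dots> = (\<integral>\<^sup>+ z. \<integral>\<^sup>+ y. e (Suc n) z * ((\<Prod>i\<in>{1..n}. e i (y i))
        * F ((\<lambda>i\<in>{1..n}. x i + s * y i)(Suc n := x (Suc n) + s * z))) \<partial>?P n \<partial>lborel)"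
  proof (intro nn_integral_cong)
    fix z :: real and y :: "nat \<Rightarrow> real"
    have "(\<Prod>i\<in>{1..Suc n}. e i ((y(Suc n := z)) i)) = e (Suc n) z * (\<Prod>i\<in>{1..n}. e i (y i))"
      unfolding ins by (subst prod.insert) (auto intro!: arg_cong2[where f = "(*)"] prod.cong)
    moreover have "(\<lambda>i\<in>{1..Suc n}. x i + s * (y(Suc n := z)) i) =
        (\<lambda>i\<in>{1..n}. x i + s * y i)(Suc n := x (Suc n) + s * z)"
      by (auto simp: restrict_def)
    ultimately show "(\<Prod>i\<in>{1..Suc n}. e i ((y(Suc n := z)) i))
        * F (\<lambda>i\<in>{1..Suc n}. x i + s * (y(Suc n := z)) i) = e (Suc n) z * ((\<Prod>i\<in>{1..n}. e i (y i))
        * F ((\<lambda>i\<in>{1..n}. x i + s * y i)(Suc n := x (Suc n) + s * z)))"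
      by (simp add: mult.assoc)
  qed
  also have "\<dots> \<le> (\<integral>\<^sup>+ z. e (Suc n) z * (?C * ?N (x (Suc n) + s * z)) \<partial>lborel)"
  proof (intro nn_integral_mono)
    fix z :: real
    let ?z = "x (Suc n) + s * z"
    have [measurable]: "(\<lambda>w. F (w(Suc n := ?z))) \<in> borel_measurable (?P n)" by (rule Gz)
    have "(\<integral>\<^sup>+ y. e (Suc n) z * ((\<Prod>i\<in>{1..n}. e i (y i))
        * F ((\<lambda>i\<in>{1..n}. x i + s * y i)(Suc n := ?z))) \<partial>?P n) =
      e (Suc n) z * (\<integral>\<^sup>+ y. ((\<Prod>i\<in>{1..n}. e i (y i))
        * (\<lambda>w. F (w(Suc n := ?z))) (\<lambda>i\<in>{1..n}. x i + s * y i)) \<partial>?P n)"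
    proof (subst nn_integral_cmult[symmetric])
      have [measurable]: "(\<lambda>y. \<lambda>i\<in>{1..n}. x i + s * y i) \<in> ?P n \<rightarrow>\<^sub>M ?P n" by measurable
      from measurable_compose[OF this Gz]
      have [measurable]: "(\<lambda>y. F ((\<lambda>i\<in>{1..n}. x i + s * y i)(Suc n := ?z))) \<in> borel_measurable (?P n)"
        by simp
      have [measurable]: "(\<lambda>y. \<Prod>i\<in>{1..n}. e i (y i)) \<in> borel_measurable (?P n)"
        using e(2) by measurable
      show "(\<lambda>y. (\<Prod>i\<in>{1..n}. e i (y i)) * F ((\<lambda>i\<in>{1..n}. x i + s * y i)(Suc n := ?z)))
          \<in> borel_measurable (?P n)"
        by measurable
    qed simp
    \<comment> \<open>The induction hypothesis is applied to the slice of \<open>F\<close> with the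
      last coordinate frozen.\<close>
    also have "\<dots> \<le> e (Suc n) z * (?C * coord_norm p n (\<lambda>w. F (w(Suc n := ?z))) (\<lambda>_. undefined))"
      using Suc.prems by (intro mult_left_mono Suc.IH Gz) auto
    finally show "(\<integral>\<^sup>+ y. e (Suc n) z * ((\<Prod>i\<in>{1..n}. e i (y i))
        * F ((\<lambda>i\<in>{1..n}. x i + s * y i)(Suc n := ?z))) \<partial>?P n) \<le> e (Suc n) z * (?C * ?N ?z)"
      by (simp add: coord_norm_fun_upd)
  qed
  also have "\<dots> = ?C * (\<integral>\<^sup>+ z. e (Suc n) z * ?N (x (Suc n) + s * z) \<partial>lborel)"
    using N by (subst nn_integral_cmult[symmetric]) (auto simp: ac_simps)
  \<comment> \<open>Hoelder in the remaining coordinate, which absorbs its affine substitution as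
    well.\<close>
  also have "\<dots> \<le> ?C * (Lp_norm (conj_exp (p (Suc n))) (e (Suc n)) * Lp_norm (p (Suc n)) ?N)"
    using Suc.prems(3) by (intro mult_left_mono Lp_norm_Holder_affine N e s) auto
  finally show ?case by (simp add: mult.assoc restrict_def)
qed

section \<open>Null sets in product spaces and Borel majorants\<close>

lemma AE_PiM_Suc:
  assumes "AE x in (\<Pi>\<^sub>M i\<in>{1..Suc n}. lborel :: real measure). Q x"
  shows "AE z in lborel. AE x in (\<Pi>\<^sub>M i\<in>{1..n}. lborel). Q (x(Suc n := z))"
proof -
  interpret product_sigma_finite "\<lambda>_ :: nat. lborel :: real measure" ..
  \<comment> \<open>The exceptional set of \<open>Q\<close> may be nonmeasurable; it is covered by a
    measurable null set \<open>N\<close>, and Tonelli shows that almost all sections of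
    \<open>N\<close> are null.\<close>
  let ?P = "\<lambda>n. \<Pi>\<^sub>M i\<in>{1..n}. lborel :: real measure"
  obtain N where N: "N \<in> null_sets (?P (Suc n))" "{x \<in> space (?P (Suc n)). \<not> Q x} \<subseteq> N"
    using assms unfolding eventually_ae_filter by auto
  then have [measurable]: "N \<in> sets (?P (Suc n))" by auto
  have ins: "{1..Suc n} = insert (Suc n) {1..n}" by auto
  have upd [measurable]: "(\<lambda>w. (snd w)(Suc n := fst w)) \<in> lborel \<Otimes>\<^sub>M ?P n \<rightarrow>\<^sub>M ?P (Suc n)"
    by (intro measurable_fun_upd[where J = "{1..n}"]) auto
  have "(\<lambda>w. indicator N ((snd w)(Suc n := fst w)) :: ennreal) \<in> borel_measurable (lborel \<Otimes>\<^sub>M ?P n)"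
    by measurable
  then have G: "(\<lambda>(z, x). indicator N (x(Suc n := z)) :: ennreal) \<in> borel_measurable (lborel \<Otimes>\<^sub>M ?P n)"
    by (simp add: case_prod_beta')
  have "(\<integral>\<^sup>+ z. \<integral>\<^sup>+ x. indicator N (x(Suc n := z)) \<partial>?P n \<partial>lborel) = (\<integral>\<^sup>+ x. indicator N x \<partial>?P (Suc n))"
    using product_nn_integral_insert_rev[of "{1..n}" "Suc n" "indicator N :: _ \<Rightarrow> ennreal"]
      borel_measurable_indicator[OF \<open>N \<in> sets (?P (Suc n))\<close>, where 'b = ennreal]
    unfolding ins[symmetric] by simp
  also have "\<dots> = emeasure (?P (Suc n)) N" by (rule nn_integral_indicator) fact
  also have "\<dots> = 0" using N(1) by (rule null_setsD1)
  finally have "AE z in lborel. (\<integral>\<^sup>+ x. indicator N (x(Suc n := z)) \<partial>?P n) = 0"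
    using sigma_finite_measure.borel_measurable_nn_integral[OF sigma_finite G]
    by (subst (asm) nn_integral_0_iff_AE) auto
  then show ?thesis
  proof eventually_elim
    case (elim z)
    then have "AE x in ?P n. indicator N (x(Suc n := z)) = (0 :: ennreal)"
      using measurable_Pair2[OF G, of z] by (subst (asm) nn_integral_0_iff_AE) auto
    then show "AE x in ?P n. Q (x(Suc n := z))"
      using AE_space
    proof eventually_elim
      case (elim x)
      then have "x(Suc n := z) \<notin> N" "x(Suc n := z) \<in> space (?P (Suc n))"
        by (auto simp: space_PiM PiE_def extensional_def split: if_splits)
      then show "Q (x(Suc n := z))" using N(2) by auto
    qed
  qed
qed

text \<open>Almost every slice in the outermost coordinate satisfies the hypothesis one dimension
  lower, and a one-dimensional norm ignores the null set of bad slices.\<close>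

lemma coord_norm_cong_AE:
  assumes "AE x in (\<Pi>\<^sub>M i\<in>{1..n}. lborel). F x = H x"
  shows "coord_norm p n F (\<lambda>_. undefined) = coord_norm p n H (\<lambda>_. undefined)"
  using assms
proof (induction n arbitrary: F H)
  case 0
  \<comment> \<open>The product over no coordinates is a unit point mass at
    \<open>\<lambda>_. undefined\<close>, so almost everywhere means at that point.\<close>
  have "{1..0::nat} = {}" by simp
  with 0 show ?case
    unfolding PiM_empty by (simp only: PiM_empty AE_count_space coord_norm.simps) auto
next
  case (Suc n)
  have "AE z in lborel. coord_norm p n (\<lambda>x. F (x(Suc n := z))) (\<lambda>_. undefined) =
      coord_norm p n (\<lambda>x. H (x(Suc n := z))) (\<lambda>_. undefined)"
    using AE_PiM_Suc[OF Suc.prems] by (rule eventually_mono) (rule Suc.IH)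
  then show ?case
    by (auto simp: coord_norm_fun_upd intro: Lp_norm_cong_AE)
qed

lemma mixed_norm_cong_AE:
  assumes "AE w in lborel \<Otimes>\<^sub>M (\<Pi>\<^sub>M i\<in>{1..2*d}. lborel). ennreal \<bar>f w\<bar> = G w"
  shows "mixed_norm d q p f = Lp_norm q (\<lambda>s. coord_norm p (2 * d) (\<lambda>x. G (s, x)) (\<lambda>_. undefined))"
proof -
  interpret product_sigma_finite "\<lambda>_ :: nat. lborel :: real measure" ..
  interpret PS: sigma_finite_measure "\<Pi>\<^sub>M i\<in>{1..2*d}. lborel :: real measure"
    by (rule sigma_finite) simp
  interpret pair_sigma_finite "lborel :: real measure" "\<Pi>\<^sub>M i\<in>{1..2*d}. lborel :: real measure" ..
  from AE_pair[OF assms] show ?thesis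
    unfolding mixed_norm_def by (intro Lp_norm_cong_AE) (auto elim!: eventually_mono intro: coord_norm_cong_AE)
qed

text \<open>Take a Borel representative and raise it to \<open>top\<close> on a null set containing
  all points of disagreement. The pointwise bound then holds on every slice, whereas almost
  everywhere equality on the product gives no information about an individual slice.\<close>

lemma ex_borel_majorant:
  fixes f :: "'a \<Rightarrow> real"
  assumes "f \<in> borel_measurable (completion M)"
  obtains G :: "'a \<Rightarrow> ennreal" where "G \<in> borel_measurable M"
    "AE w in M. ennreal \<bar>f w\<bar> = G w" "\<And>w. w \<in> space M \<Longrightarrow> ennreal \<bar>f w\<bar> \<le> G w"
proof -
  obtain g where [measurable]: "g \<in> borel_measurable M" and ae: "AE w in M. f w = g w"
    using completion_ex_borel_measurable_real[OF assms] by auto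
  from ae obtain N where N: "N \<in> null_sets M" "{w \<in> space M. f w \<noteq> g w} \<subseteq> N"
    unfolding eventually_ae_filter by auto
  have [measurable]: "N \<in> sets M" using N by auto
  show thesis
  proof
    show "(\<lambda>w. if w \<in> N then top else ennreal \<bar>g w\<bar>) \<in> borel_measurable M" by measurable
    show "AE w in M. ennreal \<bar>f w\<bar> = (if w \<in> N then top else ennreal \<bar>g w\<bar>)"
      using ae AE_not_in[OF N(1)] by eventually_elim auto
    show "ennreal \<bar>f w\<bar> \<le> (if w \<in> N then top else ennreal \<bar>g w\<bar>)" if "w \<in> space M" for w
      using N that by auto
  qed
qed

section \<open>The kernel\<close>

lemma Lp_norm_top_le:
  assumes "g \<in> borel_measurable borel" "\<And>y. g y \<le> c"
  shows "Lp_norm top g \<le> c"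
  using assms by (auto simp: Lp_norm_top intro!: esssup_I)

text \<open>For a finite exponent \<open>P\<close>, the \<open>P\<close>-th power of the Gaussian is
  a multiple of a centred normal density, whose integral is 1.\<close>

lemma Lp_norm_gaussian_finite:
  assumes p: "p \<ge> 1" and lam: "lam > 0"
  shows "Lp_norm p (\<lambda>y. ennreal (exp (- lam * y\<^sup>2))) < top"
proof (cases p)
  case top
  have "Lp_norm top (\<lambda>y. ennreal (exp (- lam * y\<^sup>2))) \<le> 1"
    using lam by (intro Lp_norm_top_le) (auto simp: ennreal_le_1)
  then show ?thesis using top by (simp add: le_less_trans[OF _ ennreal_one_less_top])
next
  case (real P)
  \<comment> \<open>Chosen so that \<open>exp (- lam * P * y\<^sup>2)\<close> equals
    \<open>exp (- y\<^sup>2 / (2 * \<sigma>\<^sup>2))\<close>.\<close>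
  define \<sigma> where "\<sigma> = sqrt (1 / (2 * (lam * P)))"
  have P: "P \<ge> 1" and lP: "lam * P > 0" using real p lam by auto
  have \<sigma>: "\<sigma> > 0" "2 * \<sigma>\<^sup>2 = 1 / (lam * P)"
    using lP by (auto simp: \<sigma>_def)
  have "(\<integral>\<^sup>+ y. enn_powr (ennreal (exp (- lam * y\<^sup>2))) P \<partial>lborel) =
      (\<integral>\<^sup>+ y. ennreal (sqrt (2 * pi * \<sigma>\<^sup>2)) * ennreal (normal_density 0 \<sigma> y) \<partial>lborel)"
  proof (intro nn_integral_cong)
    fix y :: real
    have "exp (- lam * y\<^sup>2) powr P = exp (- y\<^sup>2 / (2 * \<sigma>\<^sup>2))"
      using \<sigma> lP by (simp add: powr_def field_simps)
    also have "\<dots> = sqrt (2 * pi * \<sigma>\<^sup>2) * normal_density 0 \<sigma> y"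
      using \<sigma> by (simp add: normal_density_def)
    finally show "enn_powr (ennreal (exp (- lam * y\<^sup>2))) P =
        ennreal (sqrt (2 * pi * \<sigma>\<^sup>2)) * ennreal (normal_density 0 \<sigma> y)"
      by (simp add: enn_powr_ennreal ennreal_mult)
  qed
  also have "\<dots> = ennreal (sqrt (2 * pi * \<sigma>\<^sup>2)) * (\<integral>\<^sup>+ y. ennreal (normal_density 0 \<sigma> y) \<partial>lborel)"
    by (intro nn_integral_cmult) auto
  also have "(\<integral>\<^sup>+ y. ennreal (normal_density 0 \<sigma> y) \<partial>lborel) = 1"
    using prob_space.emeasure_space_1[OF prob_space_normal_density[OF \<sigma>(1), of 0]]
    by (simp add: emeasure_density cong: nn_integral_cong)
  finally have "(\<integral>\<^sup>+ y. enn_powr (ennreal (exp (- lam * y\<^sup>2))) P \<partial>lborel) < top"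
    by simp
  with real P show ?thesis
    by (simp add: Lp_norm_lborel)
qed

text \<open>The source of the powers of \<open>r\<close>: it is used with \<gamma> = 1/2 on the
  first block of coordinates and \<gamma> = 3/2 on the second.\<close>

lemma Lp_norm_gaussian_scale:
  assumes p: "p \<ge> 1" and r: "r > 0"
  shows "Lp_norm p (\<lambda>y. ennreal (exp (- lam * (r powr (- \<gamma>) * y)\<^sup>2))) =
    ennreal (r powr (\<gamma> * enn2real (inverse p))) * Lp_norm p (\<lambda>y. ennreal (exp (- lam * y\<^sup>2)))"
  using Lp_norm_affine[where g = "\<lambda>y. ennreal (exp (- lam * y\<^sup>2))" and c = 0 and s = "r powr (- \<gamma>)" and p = p]
    p r by (simp add: powr_powr)

lemma Lp_norm_powr_finite:
  assumes q: "q \<ge> 1" and a: "a > 0"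
  shows "Lp_norm q (\<lambda>r. ennreal (r powr (a - enn2real (inverse q))) * indicator {0..1} r) < top"
proof (cases q)
  case top
  have "Lp_norm top (\<lambda>r. ennreal (r powr a) * indicator {0..1} r) \<le> 1"
    using a by (intro Lp_norm_top_le) (auto simp: ennreal_le_1 powr_le1 split: split_indicator)
  then show ?thesis using top by (simp add: le_less_trans[OF _ ennreal_one_less_top])
next
  case (real Q)
  have Q: "Q \<ge> 1" using real q by auto
  define b where "b = a - 1 / Q"
  \<comment> \<open>The exponent of the \<open>Q\<close>-th power exceeds -1 because
    \<open>a > 0\<close>, which is integrability at 0.\<close>
  have bQ: "b * Q = a * Q - 1" using Q by (simp add: b_def field_simps)
  have inv: "enn2real (inverse q) = 1 / Q"
    using real Q by (simp add: inverse_ennreal divide_inverse)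
  have "((\<lambda>x. x powr (b * Q)) has_integral (1 powr (b * Q + 1) / (b * Q + 1))) {0..1}"
    using a Q by (intro has_integral_powr_from_0) (auto simp: bQ)
  then have "((\<lambda>x. if x \<in> {0..1} then x powr (b * Q) else 0) has_integral (1 / (b * Q + 1))) UNIV"
    unfolding has_integral_restrict_UNIV by simp
  then have "(\<integral>\<^sup>+ x. ennreal (if x \<in> {0..1} then x powr (b * Q) else 0) \<partial>lborel) = ennreal (1 / (b * Q + 1))"
    by (intro nn_integral_has_integral_lborel) auto
  moreover have "(\<integral>\<^sup>+ x. ennreal (if x \<in> {0..1} then x powr (b * Q) else 0) \<partial>lborel) =
      (\<integral>\<^sup>+ r. enn_powr (ennreal (r powr b) * indicator {0..1} r) Q \<partial>lborel)"
    by (intro nn_integral_cong) (auto simp: enn_powr_ennreal powr_powr split: split_indicator)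
  ultimately have "(\<integral>\<^sup>+ r. enn_powr (ennreal (r powr b) * indicator {0..1} r) Q \<partial>lborel) < top"
    by (metis ennreal_less_top)
  then show ?thesis
    unfolding inv b_def[symmetric] using real Q by (simp add: Lp_norm_lborel)
qed

lemma Lp_norm_indicator_finite:
  assumes p: "p \<ge> 1"
  shows "Lp_norm p (indicator {- R..R :: real}) < top"
proof (cases p)
  case top
  have "Lp_norm top (indicator {- R..R}) \<le> 1"
    by (intro Lp_norm_top_le) (auto split: split_indicator)
  then show ?thesis using top by (simp add: le_less_trans[OF _ ennreal_one_less_top])
next
  case (real P)
  then have P: "P \<ge> 1" using p by auto
  have "enn_powr (indicator {- R..R} y) P = indicator {- R..R} y" for y
    using P enn_powr_ennreal[of 1 P] by (auto split: split_indicator)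
  then have "(\<integral>\<^sup>+ y. enn_powr (indicator {- R..R} y) P \<partial>lborel) < top"
    using emeasure_lborel_cbox_eq[of "- R" R] by simp
  with real P show ?thesis
    by (simp add: Lp_norm_lborel)
qed

text \<open>Rescaling [0, T] to [0, 1] extracts \<open>T powr b\<close> from the weight and T to the
  power 1/q' from its norm, where q' is conjugate to q. These combine to \<open>T powr a\<close>, as
  b + 1/q' = a.\<close>

lemma time_Holder:
  assumes q: "q \<ge> 1" and a: "a > 0" and s: "\<bar>s\<bar> = 1" and T: "T > 0"
    and [measurable]: "\<Phi> \<in> borel_measurable borel"
  shows "(\<integral>\<^sup>+ r. ennreal (r powr (a - enn2real (inverse (conj_exp q)))) * indicator {0..T} r * \<Phi> (t + s * r) \<partial>lborel)
    \<le> ennreal (T powr a) *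
      Lp_norm (conj_exp q) (\<lambda>r. ennreal (r powr (a - enn2real (inverse (conj_exp q)))) * indicator {0..1} r) *
      Lp_norm q \<Phi>"
proof -
  define b where "b = a - enn2real (inverse (conj_exp q))"
  define h where "h r = ennreal (r powr b) * indicator {0..1} r" for r :: real
  have h [measurable]: "h \<in> borel_measurable borel" unfolding h_def by measurable
  \<comment> \<open>The argument \<open>0 + 1 / T * r\<close> has the affine shape to which the
    scaling of the norm applies.\<close>
  have "ennreal (r powr b) * indicator {0..T} r = ennreal (T powr b) * h (0 + 1 / T * r)" for r
  proof (cases "0 \<le> r \<and> r \<le> T")
    case True
    then have "T powr b * (1 / T * r) powr b = r powr b"
      using T by (simp add: powr_divide)
    with True T show ?thesis
      by (simp add: h_def flip: ennreal_mult)
  next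
    case False
    then show ?thesis using T by (auto simp: h_def zero_le_divide_iff split: split_indicator)
  qed
  then have "(\<integral>\<^sup>+ r. ennreal (r powr b) * indicator {0..T} r * \<Phi> (t + s * r) \<partial>lborel)
      = ennreal (T powr b) * (\<integral>\<^sup>+ r. h (0 + 1 / T * r) * \<Phi> (t + s * r) \<partial>lborel)"
    by (subst nn_integral_cmult[symmetric]) (auto simp: mult.assoc)
  also have "\<dots> \<le> ennreal (T powr b) * (Lp_norm (conj_exp q) (\<lambda>r. h (0 + 1 / T * r)) * Lp_norm q \<Phi>)"
    using q s by (intro mult_left_mono Lp_norm_Holder_affine) auto
  also have "Lp_norm (conj_exp q) (\<lambda>r. h (0 + 1 / T * r)) =
      ennreal (T powr (enn2real (inverse (conj_exp q)))) * Lp_norm (conj_exp q) h"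
    using T q by (subst Lp_norm_affine) (auto simp: conj_exp_ge_1 powr_divide powr_minus)
  also have "ennreal (T powr b) * (ennreal (T powr (enn2real (inverse (conj_exp q)))) * Lp_norm (conj_exp q) h * Lp_norm q \<Phi>)
      = (ennreal (T powr b) * ennreal (T powr (enn2real (inverse (conj_exp q))))) * Lp_norm (conj_exp q) h * Lp_norm q \<Phi>"
    by (simp only: mult.assoc)
  also have "ennreal (T powr b) * ennreal (T powr (enn2real (inverse (conj_exp q)))) = ennreal (T powr a)"
    using T by (simp add: b_def flip: ennreal_mult powr_add)
  finally show ?thesis unfolding h_def b_def .
qed

section \<open>Product form of the kernel and the spatial estimate\<close>

lemma eta_eq_prod:
  assumes "r > 0"
  shows "ennreal (eta d \<beta> lam r y) = ennreal (r powr (- \<beta> / 2 - 2 * real d)) *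
    (\<Prod>i\<in>{1..2*d}. ennreal (exp (- lam * (r powr (- (if i \<le> d then 1 / 2 else 3 / 2)) * y i)\<^sup>2)))"
proof -
  have "(L2_set (kin_scale d r y) {1..2*d})\<^sup>2 = (\<Sum>i\<in>{1..2*d}. (kin_scale d r y i)\<^sup>2)"
    by (simp add: L2_set_def sum_nonneg)
  also have "\<dots> = (\<Sum>i\<in>{1..2*d}. (r powr (- (if i \<le> d then 1 / 2 else 3 / 2)) * y i)\<^sup>2)"
    by (intro sum.cong) (auto simp: kin_scale_def)
  finally have "exp (- lam * (L2_set (kin_scale d r y) {1..2*d})\<^sup>2) =
      (\<Prod>i\<in>{1..2*d}. exp (- lam * (r powr (- (if i \<le> d then 1 / 2 else 3 / 2)) * y i)\<^sup>2))"
    by (simp only: sum_distrib_left) (simp add: exp_sum)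
  then show ?thesis
    unfolding eta_def by (simp add: ennreal_mult prod_nonneg prod_ennreal)
qed

lemma sum_two_blocks:
  "(\<Sum>i = 1..2 * d. if i \<le> d then f i else g i) = (\<Sum>i = 1..d. f i) + (\<Sum>i = d + 1..2 * d. g (i :: nat) :: real)"
proof -
  have "{1..2*d} = {1..d} \<union> {d+1..2*d}" by auto
  then have "(\<Sum>i = 1..2 * d. if i \<le> d then f i else g i) =
      (\<Sum>i = 1..d. if i \<le> d then f i else g i) + (\<Sum>i = d + 1..2 * d. if i \<le> d then f i else g i)"
    by (simp only:) (rule sum.union_disjoint, auto)
  then show ?thesis by simp
qed

text \<open>Coordinatewise Hoelder against the Gaussian factors; the rest is bookkeeping of powers
  of \<open>r\<close>. The definition of \<open>kappa\<close> is exactly what makes them add up to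
  (kappa - \<beta>)/2 - 1/q', with q' conjugate to q.\<close>

lemma eta_integral_le:
  assumes p: "\<forall>i\<in>{1..2*d}. p i \<ge> 1" and q: "q \<ge> 1" and r: "r > 0" and s: "\<bar>s\<bar> = 1"
    and F: "F \<in> borel_measurable (\<Pi>\<^sub>M i\<in>{1..2*d}. lborel)"
  shows "(\<integral>\<^sup>+ y. ennreal (eta d \<beta> lam r y) * F (\<lambda>k\<in>{1..2*d}. x k + s * y k) \<partial>(\<Pi>\<^sub>M i\<in>{1..2*d}. lborel))
    \<le> ennreal (r powr ((kappa d q p - \<beta>) / 2 - enn2real (inverse (conj_exp q)))) *
      (\<Prod>i\<in>{1..2*d}. Lp_norm (conj_exp (p i)) (\<lambda>y. ennreal (exp (- lam * y\<^sup>2)))) *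
      coord_norm p (2 * d) F (\<lambda>_. undefined)"
proof -
  let ?P = "\<Pi>\<^sub>M i\<in>{1..2*d}. lborel :: real measure"
  define \<gamma> :: "nat \<Rightarrow> real" where "\<gamma> i = (if i \<le> d then 1 / 2 else 3 / 2)" for i
  define e where "e i y = ennreal (exp (- lam * (r powr (- \<gamma> i) * y)\<^sup>2))" for i y
  define K where "K = (\<Prod>i\<in>{1..2*d}. Lp_norm (conj_exp (p i)) (\<lambda>y. ennreal (exp (- lam * y\<^sup>2))))"
  let ?B = "r powr (- \<beta> / 2 - 2 * real d)"
  have e [measurable]: "e i \<in> borel_measurable borel" for i
    unfolding e_def by measurable
  have [measurable]: "(\<lambda>y. \<lambda>i\<in>{1..2*d}. x i + s * y i) \<in> ?P \<rightarrow>\<^sub>M ?P" by measurable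
  from measurable_compose[OF this F]
  have [measurable]: "(\<lambda>y. F (\<lambda>i\<in>{1..2*d}. x i + s * y i)) \<in> borel_measurable ?P"
    by simp
  have "(\<integral>\<^sup>+ y. ennreal (eta d \<beta> lam r y) * F (\<lambda>k\<in>{1..2*d}. x k + s * y k) \<partial>?P)
      = ennreal ?B * (\<integral>\<^sup>+ y. (\<Prod>i\<in>{1..2*d}. e i (y i)) * F (\<lambda>k\<in>{1..2*d}. x k + s * y k) \<partial>?P)"
    unfolding eta_eq_prod[OF r] e_def[symmetric] \<gamma>_def[symmetric] mult.assoc
    by (rule nn_integral_cmult) measurable
  also have "\<dots> \<le> ennreal ?B * ((\<Prod>i\<in>{1..2*d}. Lp_norm (conj_exp (p i)) (e i)) * coord_norm p (2 * d) F (\<lambda>_. undefined))"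
    using p s by (intro mult_left_mono coord_norm_Holder F e) auto
  also have "(\<Prod>i\<in>{1..2*d}. Lp_norm (conj_exp (p i)) (e i)) =
      (\<Prod>i\<in>{1..2*d}. ennreal (r powr (\<gamma> i * (1 - enn2real (inverse (p i))))) *
        Lp_norm (conj_exp (p i)) (\<lambda>y. ennreal (exp (- lam * y\<^sup>2))))"
    using p r unfolding e_def
    by (intro prod.cong refl) (subst Lp_norm_gaussian_scale, auto simp: conj_exp_ge_1 inverse_conj_exp)
  also have "\<dots> = ennreal (r powr (\<Sum>i = 1..2*d. \<gamma> i * (1 - enn2real (inverse (p i))))) * K"
    using r by (simp add: prod.distrib K_def prod_ennreal powr_sum)
  also have "(\<Sum>i = 1..2*d. \<gamma> i * (1 - enn2real (inverse (p i)))) =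
      (\<Sum>i = 1..d. 1 / 2 * (1 - enn2real (inverse (p i)))) + (\<Sum>i = d + 1..2 * d. 3 / 2 * (1 - enn2real (inverse (p i))))"
    unfolding sum_two_blocks[symmetric] \<gamma>_def by (intro sum.cong) auto
  \<comment> \<open>The constant parts of the two blocks are d/2 and 3d/2.\<close>
  also have "\<dots> = 2 * real d - 1 / 2 * (\<Sum>i = 1..d. enn2real (inverse (p i)))
      - 1 / 2 * (\<Sum>i = d + 1..2 * d. 3 * enn2real (inverse (p i)))"
    by (simp add: sum_subtractf right_diff_distrib flip: sum_distrib_left sum_divide_distrib)
  also have "\<dots> = 2 * real d + kappa d q p / 2 - 1 + enn2real (inverse q)"
    by (simp add: kappa_def field_simps)
  also have "ennreal ?B * (ennreal (r powr (2 * real d + kappa d q p / 2 - 1 + enn2real (inverse q))) * K * coord_norm p (2 * d) F (\<lambda>_. undefined))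
    = (ennreal ?B * ennreal (r powr (2 * real d + kappa d q p / 2 - 1 + enn2real (inverse q)))) * K * coord_norm p (2 * d) F (\<lambda>_. undefined)"
    by (simp only: mult.assoc)
  \<comment> \<open>The term 2d cancels against the normalisation of the kernel, and -1 + 1/q
    becomes -1/q'.\<close>
  also have "ennreal ?B * ennreal (r powr (2 * real d + kappa d q p / 2 - 1 + enn2real (inverse q))) =
      ennreal (r powr ((kappa d q p - \<beta>) / 2 - enn2real (inverse (conj_exp q))))"
    using r q by (auto simp: inverse_conj_exp diff_divide_distrib simp flip: ennreal_mult powr_add
        intro!: arg_cong[where f = "\<lambda>z. r powr z"])
  finally show ?thesis unfolding K_def .
qed

section \<open>The Kato classes\<close>

text \<open>The spatial estimate is inserted for each \<open>r\<close> and the time estimate is then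
  integrated. Both are uniform in the base point, so they pass to the suprema; the factor 4 counts
  the sign choices.\<close>

lemma Kato_le:
  assumes p: "\<forall>i\<in>{1..2*d}. p i \<ge> 1" and q: "q \<ge> 1" and \<beta>: "\<beta> < kappa d q p" and T: "T > 0"
    and f: "f \<in> borel_measurable (lebesgue_tx d)"
  shows "Kato d \<beta> lam f T \<le> 4 *
    ((\<Prod>i\<in>{1..2*d}. Lp_norm (conj_exp (p i)) (\<lambda>y. ennreal (exp (- lam * y\<^sup>2)))) *
     Lp_norm (conj_exp q)
       (\<lambda>r. ennreal (r powr ((kappa d q p - \<beta>) / 2 - enn2real (inverse (conj_exp q)))) * indicator {0..1} r)) *
    ennreal (T powr ((kappa d q p - \<beta>) / 2)) * mixed_norm d q p f"
    (is "_ \<le> 4 * (?K * ?H) * ennreal (T powr ?a) * _")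
proof -
  let ?P = "\<Pi>\<^sub>M i\<in>{1..2*d}. lborel :: real measure"
  let ?I = "{0, 1 :: nat}"
  interpret product_sigma_finite "\<lambda>_ :: nat. lborel :: real measure" ..
  interpret PS: sigma_finite_measure ?P
    by (rule sigma_finite) simp
  obtain G where G: "G \<in> borel_measurable (lborel \<Otimes>\<^sub>M ?P)" "AE w in lborel \<Otimes>\<^sub>M ?P. ennreal \<bar>f w\<bar> = G w"
    and fG: "\<And>w. w \<in> space (lborel \<Otimes>\<^sub>M ?P) \<Longrightarrow> ennreal \<bar>f w\<bar> \<le> G w"
    using ex_borel_majorant f unfolding lebesgue_tx_def by blast
  define \<Phi> where "\<Phi> s = coord_norm p (2 * d) (\<lambda>x. G (s, x)) (\<lambda>_. undefined)" for s
  have mixed: "mixed_norm d q p f = Lp_norm q \<Phi>"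
    unfolding \<Phi>_def by (rule mixed_norm_cong_AE) (rule G)
  have Gs: "(\<lambda>x. G (s, x)) \<in> borel_measurable ?P" for s
    using measurable_Pair2[OF G(1), of s] by simp
  have "\<Phi> \<in> borel_measurable lborel"
    unfolding \<Phi>_def using G(1) by (intro measurable_coord_norm_undefined) (simp add: case_prod_beta')
  then have \<Phi> [measurable]: "\<Phi> \<in> borel_measurable borel" by simp
  let ?b = "?a - enn2real (inverse (conj_exp q))"
  have sgn: "\<bar>(- 1) ^ i\<bar> = (1 :: real)" for i :: nat
    by (simp add: power_abs)
  show ?thesis
    unfolding Kato_def
  proof (intro SUP_least)
    fix t :: real and x :: "nat \<Rightarrow> real"
    define J where "J r = (\<integral>\<^sup>+ y. ennreal (eta d \<beta> lam r y) * (\<Sum>i\<in>?I. \<Sum>j\<in>?I.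
      ennreal \<bar>f (t + (- 1) ^ i * r, \<lambda>k\<in>{1..2*d}. x k + (- 1) ^ j * y k)\<bar>) \<partial>lebesgue_pow (2 * d))" for r
    have J: "J r \<le> (\<Sum>i\<in>?I. \<Sum>j\<in>?I. ennreal (r powr ?b) * ?K * \<Phi> (t + (- 1) ^ i * r))" if "r \<ge> 0" for r
    proof (cases "r = 0")
      case True
      \<comment> \<open>\<open>0 powr _\<close> is 0, so the kernel vanishes at time 0.\<close>
      then show ?thesis by (simp add: J_def eta_def)
    next
      case False
      with that have r: "r > 0" by simp
      have aff: "(\<lambda>y. \<lambda>k\<in>{1..2*d}. x k + (- 1) ^ j * y k) \<in> ?P \<rightarrow>\<^sub>M ?P" for j :: nat
        by measurable
      have Gm [measurable]: "(\<lambda>y. G (s, \<lambda>k\<in>{1..2*d}. x k + (- 1) ^ j * y k)) \<in> borel_measurable ?P"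
        for s and j :: nat
        using measurable_compose[OF aff Gs] by simp
      have eta [measurable]: "(\<lambda>y. ennreal (eta d \<beta> lam r y)) \<in> borel_measurable ?P"
        unfolding eta_eq_prod[OF r] by measurable
      have "J r = (\<integral>\<^sup>+ y. ennreal (eta d \<beta> lam r y) * (\<Sum>i\<in>?I. \<Sum>j\<in>?I.
        ennreal \<bar>f (t + (- 1) ^ i * r, \<lambda>k\<in>{1..2*d}. x k + (- 1) ^ j * y k)\<bar>) \<partial>?P)"
        by (simp add: J_def lebesgue_pow_def nn_integral_completion)
      also have "\<dots> \<le> (\<integral>\<^sup>+ y. ennreal (eta d \<beta> lam r y) * (\<Sum>i\<in>?I. \<Sum>j\<in>?I.
        G (t + (- 1) ^ i * r, \<lambda>k\<in>{1..2*d}. x k + (- 1) ^ j * y k)) \<partial>?P)"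
        \<comment> \<open>Here the majorant must dominate at every point, since the time slice is
          fixed.\<close>
        by (intro nn_integral_mono mult_left_mono sum_mono fG) (auto simp: space_pair_measure space_PiM)
      also have "\<dots> = (\<integral>\<^sup>+ y. (\<Sum>i\<in>?I. \<Sum>j\<in>?I. ennreal (eta d \<beta> lam r y) *
        G (t + (- 1) ^ i * r, \<lambda>k\<in>{1..2*d}. x k + (- 1) ^ j * y k)) \<partial>?P)"
        by (simp only: sum_distrib_left)
      also have "\<dots> = (\<Sum>i\<in>?I. \<Sum>j\<in>?I. \<integral>\<^sup>+ y. ennreal (eta d \<beta> lam r y) *
        G (t + (- 1) ^ i * r, \<lambda>k\<in>{1..2*d}. x k + (- 1) ^ j * y k) \<partial>?P)"
        by (subst nn_integral_sum, measurable, intro sum.cong refl nn_integral_sum) measurable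
      also have "\<dots> \<le> (\<Sum>i\<in>?I. \<Sum>j\<in>?I. ennreal (r powr ?b) * ?K * \<Phi> (t + (- 1) ^ i * r))"
        unfolding \<Phi>_def by (intro sum_mono eta_integral_le p q r sgn Gs)
      finally show ?thesis .
    qed
    have int: "(\<integral>\<^sup>+ r. ennreal (r powr ?b) * indicator {0..T} r * \<Phi> (t + (- 1) ^ i * r) \<partial>lborel)
        \<le> ennreal (T powr ?a) * ?H * Lp_norm q \<Phi>" for i :: nat
      using q T \<beta> by (intro time_Holder sgn \<Phi>) auto
    have "(\<integral>\<^sup>+ r\<in>{0..T}. J r \<partial>lebesgue) = (\<integral>\<^sup>+ r\<in>{0..T}. J r \<partial>lborel)"
      by (rule nn_integral_completion)
    also have "\<dots> \<le> (\<integral>\<^sup>+ r. (\<Sum>i\<in>?I. \<Sum>j\<in>?I.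
        ?K * (ennreal (r powr ?b) * indicator {0..T} r * \<Phi> (t + (- 1) ^ i * r))) \<partial>lborel)"
    proof (intro nn_integral_mono)
      fix r
      show "J r * indicator {0..T} r \<le> (\<Sum>i\<in>?I. \<Sum>j\<in>?I.
        ?K * (ennreal (r powr ?b) * indicator {0..T} r * \<Phi> (t + (- 1) ^ i * r)))"
      proof (cases "r \<in> {0..T}")
        case True
        then show ?thesis using J[of r] by (simp add: ac_simps)
      qed simp
    qed
    also have "\<dots> = (\<Sum>i\<in>?I. \<Sum>j\<in>?I. ?K *
        (\<integral>\<^sup>+ r. ennreal (r powr ?b) * indicator {0..T} r * \<Phi> (t + (- 1) ^ i * r) \<partial>lborel))"
      by (subst nn_integral_sum, measurable, intro sum.cong refl, subst nn_integral_sum, measurable,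
          intro sum.cong refl nn_integral_cmult) measurable
    also have "\<dots> \<le> (\<Sum>i\<in>?I. \<Sum>j\<in>?I. ?K * (ennreal (T powr ?a) * ?H * Lp_norm q \<Phi>))"
      by (intro sum_mono mult_left_mono int) simp
    also have "\<dots> = 4 * (?K * ?H) * ennreal (T powr ?a) * mixed_norm d q p f"
      by (simp add: mixed mult.assoc mult.left_commute flip: mult_2)
    finally show "(\<integral>\<^sup>+ r\<in>{0..T}. (\<integral>\<^sup>+ y. ennreal (eta d \<beta> lam r y) * (\<Sum>i\<in>?I. \<Sum>j\<in>?I.
      ennreal \<bar>f (t + (- 1) ^ i * r, \<lambda>k\<in>{1..2*d}. x k + (- 1) ^ j * y k)\<bar>) \<partial>lebesgue_pow (2 * d)) \<partial>lebesgue)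
      \<le> 4 * (?K * ?H) * ennreal (T powr ?a) * mixed_norm d q p f"
      unfolding J_def .
  qed
qed

text \<open>The time integral runs over a single point. At \<open>T = 0\<close> the right side of
  the estimate is 0 even for an infinite norm, so exact vanishing is required.\<close>

lemma Kato_0: "Kato d \<beta> lam f 0 = 0"
proof -
  have "(\<integral>\<^sup>+ r\<in>{0..0}. J r \<partial>lebesgue) = 0" for J :: "real \<Rightarrow> ennreal"
  proof -
    have "(\<integral>\<^sup>+ r\<in>{0..0}. J r \<partial>lborel) = (\<integral>\<^sup>+ r. 0 \<partial>(lborel :: real measure))"
      using AE_lborel_singleton[of "0 :: real"] by (intro nn_integral_cong_AE) auto
    then show ?thesis by (simp add: nn_integral_completion)
  qed
  then show ?thesis
    unfolding Kato_def by (intro antisym SUP_least) auto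
qed

lemma prod_less_top:
  fixes g :: "'a \<Rightarrow> ennreal"
  shows "(\<And>i. i \<in> I \<Longrightarrow> g i < top) \<Longrightarrow> prod g I < top"
  by (induction I rule: infinite_finite_induct) (auto simp: ennreal_mult_less_top)

lemma Kato_estimate:
  assumes p: "\<forall>i\<in>{1..2*d}. p i \<ge> 1" and q: "q \<ge> 1" and \<beta>: "\<beta> < kappa d q p" and lam: "lam > 0"
  obtains C :: real where "C > 0" "\<And>T f. T \<ge> 0 \<Longrightarrow> f \<in> borel_measurable (lebesgue_tx d) \<Longrightarrow>
    Kato d \<beta> lam f T \<le> ennreal (C * T powr ((kappa d q p - \<beta>) / 2)) * mixed_norm d q p f"
proof -
  let ?a = "(kappa d q p - \<beta>) / 2"
  define A where "A = 4 * ((\<Prod>i\<in>{1..2*d}. Lp_norm (conj_exp (p i)) (\<lambda>y. ennreal (exp (- lam * y\<^sup>2)))) *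
     Lp_norm (conj_exp q) (\<lambda>r. ennreal (r powr (?a - enn2real (inverse (conj_exp q)))) * indicator {0..1} r))"
  have fin: "(\<Prod>i\<in>{1..2*d}. Lp_norm (conj_exp (p i)) (\<lambda>y. ennreal (exp (- lam * y\<^sup>2)))) < top"
    by (intro prod_less_top Lp_norm_gaussian_finite conj_exp_ge_1 lam) (use p in auto)
  have "A < top"
    unfolding A_def using q \<beta> fin
    by (auto intro!: ennreal_mult_less_top[THEN iffD2] Lp_norm_powr_finite conj_exp_ge_1 simp: ennreal_mult_less_top)
  \<comment> \<open>The summand 1 makes the constant strictly positive.\<close>
  define C where "C = enn2real A + 1"
  have A: "A \<le> ennreal C"
    using \<open>A < top\<close> by (cases A) (auto simp: C_def)
  show thesis
  proof
    show "C > 0" by (simp add: C_def add_nonneg_pos)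
    fix T :: real and f :: "real \<times> (nat \<Rightarrow> real) \<Rightarrow> real"
    assume T: "T \<ge> 0" and f: "f \<in> borel_measurable (lebesgue_tx d)"
    show "Kato d \<beta> lam f T \<le> ennreal (C * T powr ?a) * mixed_norm d q p f"
    proof (cases "T = 0")
      case True
      then show ?thesis by (simp add: Kato_0)
    next
      case False
      then have "Kato d \<beta> lam f T \<le> A * ennreal (T powr ?a) * mixed_norm d q p f"
        unfolding A_def using T by (intro Kato_le p q \<beta> f) auto
      also have "\<dots> \<le> ennreal C * ennreal (T powr ?a) * mixed_norm d q p f"
        by (intro mult_right_mono A) auto
      finally show ?thesis
        using \<open>C > 0\<close> by (simp add: ennreal_mult)
    qed
  qed
qed

section \<open>Local integrability\<close>

lemma borel_sets_tx:
  fixes n :: nat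
  assumes "A \<in> sets borel"
  shows "A \<inter> space (lborel \<Otimes>\<^sub>M (\<Pi>\<^sub>M i\<in>{1..n}. lborel)) \<in> sets (lborel \<Otimes>\<^sub>M (\<Pi>\<^sub>M i\<in>{1..n}. lborel :: real measure))"
proof -
  let ?P = "\<Pi>\<^sub>M i\<in>{1..n}. lborel :: real measure"
  \<comment> \<open>Compares the topology on all functions from \<open>nat\<close> with the product
    over \<open>{1..n}\<close>: on the smaller space, every other coordinate is the constant
    \<open>undefined\<close>. Compact sets thereby become measurable.\<close>
  have "(\<lambda>x. x) \<in> ?P \<rightarrow>\<^sub>M (borel :: (nat \<Rightarrow> real) measure)"
  proof (rule measurable_coordinatewise_then_product)
    fix i
    show "(\<lambda>x. x i) \<in> borel_measurable ?P"
    proof (cases "i \<in> {1..n}")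
      case True
      from measurable_component_singleton[OF this, where M = "\<lambda>_. lborel"] show ?thesis by simp
    next
      case False
      then have "(\<lambda>x. x i) \<in> borel_measurable ?P \<longleftrightarrow> (\<lambda>x. undefined :: real) \<in> borel_measurable ?P"
        by (intro measurable_cong) (auto simp: space_PiM PiE_def extensional_def)
      then show ?thesis by simp
    qed
  qed
  then have "(\<lambda>w. (fst w, snd w)) \<in> lborel \<Otimes>\<^sub>M ?P \<rightarrow>\<^sub>M borel \<Otimes>\<^sub>M (borel :: (nat \<Rightarrow> real) measure)"
    by measurable
  then have "(\<lambda>w. w) \<in> lborel \<Otimes>\<^sub>M ?P \<rightarrow>\<^sub>M borel"
    by (simp add: borel_prod)
  from measurable_sets[OF this assms] show ?thesis
    by simp
qed

lemma mixed_space_subset_L1_loc: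
  assumes p: "\<forall>i\<in>{1..2*d}. p i \<ge> 1" and q: "q \<ge> 1"
  shows "mixed_space d q p \<subseteq> L1_loc d"
proof
  fix f assume "f \<in> mixed_space d q p"
  then have f: "f \<in> borel_measurable (lebesgue_tx d)" and fin: "mixed_norm d q p f < top"
    by (auto simp: mixed_space_def)
  let ?P = "\<Pi>\<^sub>M i\<in>{1..2*d}. lborel :: real measure"
  interpret product_sigma_finite "\<lambda>_ :: nat. lborel :: real measure" ..
  interpret PS: sigma_finite_measure ?P
    by (rule sigma_finite) simp
  obtain G where G: "G \<in> borel_measurable (lborel \<Otimes>\<^sub>M ?P)" "AE w in lborel \<Otimes>\<^sub>M ?P. ennreal \<bar>f w\<bar> = G w"
    using ex_borel_majorant f unfolding lebesgue_tx_def by blast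
  note [measurable] = G(1)
  define \<Phi> where "\<Phi> s = coord_norm p (2 * d) (\<lambda>x. G (s, x)) (\<lambda>_. undefined)" for s
  have mixed: "mixed_norm d q p f = Lp_norm q \<Phi>"
    unfolding \<Phi>_def by (rule mixed_norm_cong_AE) (rule G)
  have Gs: "(\<lambda>x. G (s, x)) \<in> borel_measurable ?P" for s
    using measurable_Pair2[OF G(1), of s] by simp
  have "\<Phi> \<in> borel_measurable lborel"
    unfolding \<Phi>_def using G(1) by (intro measurable_coord_norm_undefined) (simp add: case_prod_beta')
  then have \<Phi> [measurable]: "\<Phi> \<in> borel_measurable borel" by simp
  have "set_integrable (lebesgue_tx d) A f" if A: "compact A" "A \<subseteq> UNIV \<times> real_pow (2 * d)" for A
  proof -
    have "A \<in> sets (lborel \<Otimes>\<^sub>M ?P)"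
      using borel_sets_tx[of A "2 * d"] A
      by (simp add: borel_compact Int_absorb2 space_pair_measure space_PiM)
    then have A_sets: "A \<in> sets (lebesgue_tx d)"
      by (simp add: lebesgue_tx_def)
    \<comment> \<open>Continuous projections of a compact set are bounded, so \<open>A\<close> lies
      in a box whose indicator is a product of one-dimensional indicators.\<close>
    have "bounded (fst ` A)"
      using A(1) by (intro compact_imp_bounded compact_continuous_image continuous_intros)
    then obtain S where S: "\<And>w. w \<in> A \<Longrightarrow> \<bar>fst w\<bar> \<le> S"
      by (auto simp: bounded_iff)
    have "\<exists>R. \<forall>w\<in>A. \<bar>snd w i\<bar> \<le> R" for i
    proof -
      have "bounded ((\<lambda>w. snd w i) ` A)"
        using A(1)
        by (intro compact_imp_bounded compact_continuous_image
            continuous_on_compose2[OF continuous_on_product_coordinates[of i] continuous_on_snd] continuous_intros) auto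
      then show ?thesis by (auto simp: bounded_iff)
    qed
    then obtain R where R: "\<And>i w. w \<in> A \<Longrightarrow> \<bar>snd w i\<bar> \<le> R i"
      by metis
    let ?s = "indicator {- S..S} :: real \<Rightarrow> ennreal"
    let ?e = "\<lambda>i. indicator {- R i..R i} :: real \<Rightarrow> ennreal"
    let ?K = "\<Prod>i\<in>{1..2*d}. Lp_norm (conj_exp (p i)) (?e i)"
    have "(\<integral>\<^sup>+ w. ennreal (norm (indicator A w *\<^sub>R f w)) \<partial>lebesgue_tx d) =
        (\<integral>\<^sup>+ w. ennreal (norm (indicator A w *\<^sub>R f w)) \<partial>(lborel \<Otimes>\<^sub>M ?P))"
      unfolding lebesgue_tx_def by (rule nn_integral_completion)
    also have "\<dots> \<le> (\<integral>\<^sup>+ w. ?s (fst w) * ((\<Prod>i\<in>{1..2*d}. ?e i (snd w i)) * G w) \<partial>(lborel \<Otimes>\<^sub>M ?P))"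
    proof (rule nn_integral_mono_AE, use G(2) in eventually_elim)
      case (elim w)
      show ?case
      proof (cases "w \<in> A")
        case True
        then have "?s (fst w) = 1" "\<And>i. ?e i (snd w i) = 1"
          using S[OF True] R[OF True] by (auto simp: indicator_def abs_le_iff minus_le_iff)
        with True elim show ?thesis by simp
      qed simp
    qed
    also have "\<dots> = (\<integral>\<^sup>+ s. \<integral>\<^sup>+ x. ?s s * ((\<Prod>i\<in>{1..2*d}. ?e i (x i)) * G (s, x)) \<partial>?P \<partial>lborel)"
    proof (subst PS.nn_integral_fst[symmetric])
      show "(\<lambda>w. ?s (fst w) * ((\<Prod>i\<in>{1..2*d}. ?e i (snd w i)) * G w)) \<in> borel_measurable (lborel \<Otimes>\<^sub>M ?P)"
        by measurable
    qed simp
    also have "\<dots> = (\<integral>\<^sup>+ s. ?s s * (\<integral>\<^sup>+ x. (\<Prod>i\<in>{1..2*d}. ?e i (x i)) * G (s, x) \<partial>?P) \<partial>lborel)"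
      using Gs by (intro nn_integral_cong nn_integral_cmult) auto
    also have "\<dots> \<le> (\<integral>\<^sup>+ s. ?s s * (?K * \<Phi> s) \<partial>lborel)"
    proof (intro nn_integral_mono mult_left_mono)
      fix s
      \<comment> \<open>The point is rewritten as a trivial affine image, the form to which the
        iterated Hoelder bound applies.\<close>
      have "(\<integral>\<^sup>+ x. (\<Prod>i\<in>{1..2*d}. ?e i (x i)) * G (s, x) \<partial>?P) =
          (\<integral>\<^sup>+ x. (\<Prod>i\<in>{1..2*d}. ?e i (x i)) * G (s, \<lambda>i\<in>{1..2*d}. 0 + 1 * x i) \<partial>?P)"
        by (intro nn_integral_cong) (simp add: space_PiM PiE_restrict)
      also have "\<dots> \<le> ?K * \<Phi> s"
        unfolding \<Phi>_def using p by (intro coord_norm_Holder[where F = "\<lambda>x. G (s, x)"] Gs) auto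
      finally show "(\<integral>\<^sup>+ x. (\<Prod>i\<in>{1..2*d}. ?e i (x i)) * G (s, x) \<partial>?P) \<le> ?K * \<Phi> s" .
    qed simp
    also have "\<dots> = ?K * (\<integral>\<^sup>+ s. ?s s * \<Phi> s \<partial>lborel)"
      by (subst nn_integral_cmult[symmetric]) (auto simp: ac_simps)
    also have "\<dots> \<le> ?K * (Lp_norm (conj_exp q) ?s * Lp_norm q \<Phi>)"
      using q by (intro mult_left_mono Lp_norm_Holder) auto
    also have "\<dots> < top"
    proof -
      have "?K < top"
        using p by (intro prod_less_top) (auto intro!: Lp_norm_indicator_finite conj_exp_ge_1)
      then show ?thesis
        using q fin Lp_norm_indicator_finite[OF conj_exp_ge_1[OF q], of S]
        by (simp add: mixed ennreal_mult_less_top)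
    qed
    finally have "(\<integral>\<^sup>+ w. ennreal (norm (indicator A w *\<^sub>R f w)) \<partial>lebesgue_tx d) < \<infinity>"
      by simp
    moreover have "(\<lambda>w. indicator A w *\<^sub>R f w) \<in> borel_measurable (lebesgue_tx d)"
      using f A_sets by measurable
    ultimately show ?thesis
      unfolding set_integrable_def by (simp add: integrable_iff_bounded)
  qed
  with f show "f \<in> L1_loc d"
    by (auto simp: L1_loc_def)
qed

section \<open>Membership in the Kato classes\<close>

lemma mixed_space_subset_Kato_class_p:
  assumes p: "\<forall>i\<in>{1..2*d}. p i \<ge> 1" and q: "q \<ge> 1" and \<beta>: "\<beta> < kappa d q p"
  shows "mixed_space d q p \<subseteq> Kato_class_p d \<beta>"
proof
  fix f assume f_mixed: "f \<in> mixed_space d q p"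
  then have f: "f \<in> borel_measurable (lebesgue_tx d)" and fin: "mixed_norm d q p f < top"
    by (auto simp: mixed_space_def)
  define a where "a = (kappa d q p - \<beta>) / 2"
  have a: "a > 0" using \<beta> by (simp add: a_def)
  \<comment> \<open>All three class conditions follow from this power bound: finiteness at
    \<open>T = 1\<close>, decay at 0 because \<open>a > 0\<close>, and the integral condition by
    taking a high power.\<close>
  have bound: "\<exists>B\<ge>0. \<forall>T\<ge>0. Kato d \<beta> lam f T \<le> ennreal (B * T powr a)" if lam: "lam > 0" for lam
  proof -
    obtain C where C: "C > 0"
      "\<And>T f. T \<ge> 0 \<Longrightarrow> f \<in> borel_measurable (lebesgue_tx d) \<Longrightarrow>
        Kato d \<beta> lam f T \<le> ennreal (C * T powr a) * mixed_norm d q p f"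
      using Kato_estimate[OF p q \<beta> lam] unfolding a_def by blast
    show ?thesis
    proof (intro exI[of _ "C * enn2real (mixed_norm d q p f)"] conjI allI impI)
      fix T :: real assume "T \<ge> 0"
      from C(2)[OF this f]
      have "Kato d \<beta> lam f T \<le> ennreal (C * T powr a) * ennreal (enn2real (mixed_norm d q p f))"
        using fin by simp
      also have "\<dots> = ennreal (C * enn2real (mixed_norm d q p f) * T powr a)"
        using C(1) by (simp add: ac_simps flip: ennreal_mult)
      finally show "Kato d \<beta> lam f T \<le> ennreal (C * enn2real (mixed_norm d q p f) * T powr a)" .
    qed (use C in simp)
  qed
  have "Kato d \<beta> lam f 1 < top" if lam: "lam > 0" for lam
  proof -
    obtain B where "\<forall>T\<ge>0. Kato d \<beta> lam f T \<le> ennreal (B * T powr a)"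
      using bound[OF lam] by blast
    then have "Kato d \<beta> lam f 1 \<le> ennreal (B * 1 powr a)"
      using zero_le_one by blast
    then show ?thesis
      using le_less_trans ennreal_less_top by blast
  qed
  with f_mixed have 1: "f \<in> Kato_class d \<beta>"
    using mixed_space_subset_L1_loc[OF p q] by (auto simp: Kato_class_def)
  have "((\<lambda>\<delta>. Kato d \<beta> lam f \<delta>) \<longlongrightarrow> 0) (at_right 0)" if lam: "lam > 0" for lam
  proof -
    obtain B where B: "\<forall>T\<ge>0. Kato d \<beta> lam f T \<le> ennreal (B * T powr a)"
      using bound[OF lam] by blast
    have "((\<lambda>T. B * T powr a) \<longlongrightarrow> B * 0 powr a) (at_right 0)"
      using a by (intro tendsto_intros tendsto_powr2) (auto simp: eventually_at_right_less intro: eventually_mono[OF eventually_at_right_less])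
    then have "((\<lambda>T. ennreal (B * T powr a)) \<longlongrightarrow> ennreal 0) (at_right 0)"
      by (intro tendsto_ennrealI) simp
    then have lim: "((\<lambda>T. ennreal (B * T powr a)) \<longlongrightarrow> 0) (at_right 0)" by simp
    show ?thesis
    proof (rule tendsto_sandwich[OF _ _ tendsto_const lim])
      show "\<forall>\<^sub>F T in at_right 0. Kato d \<beta> lam f T \<le> ennreal (B * T powr a)"
        using eventually_at_right_less[of "0 :: real"] by eventually_elim (use B in auto)
    qed simp
  qed
  with 1 have 2: "f \<in> Kato_class_o d \<beta>"
    by (auto simp: Kato_class_o_def)
  have "\<exists>N::nat. (\<integral>\<^sup>+ r\<in>{0..1}. (ennreal (r powr (- c)) * (Kato d \<beta> lam f r) ^ N) \<partial>lebesgue) < top"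
    if c: "c > 0" and lam: "lam > 0" for c lam
  proof -
    obtain B where B: "B \<ge> 0" "\<forall>T\<ge>0. Kato d \<beta> lam f T \<le> ennreal (B * T powr a)"
      using bound[OF lam] by blast
    \<comment> \<open>With \<open>N\<close> at least \<open>c / a\<close>, the decay of order
      \<open>a * N\<close> compensates the singularity \<open>r powr (- c)\<close>, so the integrand
      is bounded by \<open>B ^ N\<close>.\<close>
    obtain N :: nat where "c / a \<le> real N"
      using real_arch_simple by blast
    then have N: "c \<le> a * real N"
      using a by (simp add: field_simps)
    have "ennreal (r powr (- c)) * (Kato d \<beta> lam f r) ^ N \<le> ennreal (B ^ N)" if r: "r \<in> {0..1}" for r
    \<comment> \<open>At \<open>r = 0\<close> the left side is 0, because
      \<open>0 powr (- c)\<close> is 0.\<close>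
    proof (cases "r = 0")
      case False
      with r have r: "0 < r" "r \<le> 1" by auto
      have "ennreal (r powr (- c)) * (Kato d \<beta> lam f r) ^ N \<le> ennreal (r powr (- c)) * ennreal (B * r powr a) ^ N"
        using B r by (intro mult_left_mono power_mono) auto
      also have "\<dots> = ennreal (r powr (- c) * (B ^ N * r powr (a * real N)))"
        using B r by (simp add: ennreal_power power_mult_distrib powr_powr flip: ennreal_mult powr_realpow)
      also have "\<dots> = ennreal (B ^ N * r powr (a * real N - c))"
        using r by (simp add: ac_simps flip: powr_add)
      also have "\<dots> \<le> ennreal (B ^ N * 1)"
        using B r N by (intro ennreal_leI mult_left_mono powr_le1) auto
      finally show ?thesis by simp
    qed simp
    then have "(\<integral>\<^sup>+ r\<in>{0..1}. (ennreal (r powr (- c)) * (Kato d \<beta> lam f r) ^ N) \<partial>lebesgue)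
        \<le> (\<integral>\<^sup>+ r. ennreal (B ^ N) * indicator {0..1 :: real} r \<partial>lebesgue)"
      by (intro nn_integral_mono) (auto split: split_indicator)
    also have "\<dots> = ennreal (B ^ N)"
      by (simp add: nn_integral_completion nn_integral_cmult)
    also have "\<dots> < top" by simp
    finally show ?thesis by blast
  qed
  with 2 show "f \<in> Kato_class_p d \<beta>"
    by (auto simp: Kato_class_p_def)
qed

theorem lemma2p6:
  fixes d :: nat and q :: ennreal and p :: "nat \<Rightarrow> ennreal"
  assumes "d \<ge> 1"
    and "q \<ge> 1"
    and "\<forall>i\<in>{1..2*d}. p i \<ge> 1"
    and "kappa d q p > 0"
  shows "(\<forall>\<beta>\<in>{0..<kappa d q p}. \<forall>lam>0. \<exists>C>0. \<forall>T\<in>{0..1}. \<forall>f\<in>borel_measurable (lebesgue_tx d).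
            Kato d \<beta> lam f T \<le> ennreal (C * T powr ((kappa d q p - \<beta>) / 2)) * mixed_norm d q p f)
       \<and> (\<forall>\<beta>\<in>{0..<kappa d q p}. mixed_space d q p \<subseteq> Kato_class_p d \<beta>)"
proof (intro conjI ballI allI impI)
  fix \<beta> lam :: real assume "\<beta> \<in> {0..<kappa d q p}" "lam > 0"
  then obtain C where "C > 0" "\<And>T f. T \<ge> 0 \<Longrightarrow> f \<in> borel_measurable (lebesgue_tx d) \<Longrightarrow>
    Kato d \<beta> lam f T \<le> ennreal (C * T powr ((kappa d q p - \<beta>) / 2)) * mixed_norm d q p f"
    using Kato_estimate[OF assms(3,2), of \<beta> lam] by auto
  then show "\<exists>C>0. \<forall>T\<in>{0..1}. \<forall>f\<in>borel_measurable (lebesgue_tx d).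
      Kato d \<beta> lam f T \<le> ennreal (C * T powr ((kappa d q p - \<beta>) / 2)) * mixed_norm d q p f"
    by (intro exI[of _ C]) auto
qed (use mixed_space_subset_Kato_class_p[OF assms(3,2)] in auto)

end
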